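(* Let $G$ be a finitely generated torsion-free group and let $G\cong H_1*\dots*H_k*F_r$ be a free decomposition, where $F_r$ is free of rank $r$ and each $H_i$ is nontrivial. Let $\phi$ be an automorphism of $G$ that preserves the associated free factor system $(H_1,\dots,H_k)$. Assume that $k+r\ge 3$, that $\phi$ is fully irreducible relative to $(H_1,\dots,H_k)$, that $\phi$ is atoroidal relative to $(H_1,\dots,H_k)$, and that there exist no twinned subgroups for $\phi$. Then the mapping torus $\Gamma=G\rtimes_\phi\mathbb Z$ acts (by affine isometries) on a Hilbert space with unbounded orbits, and with no global fixed point for $G$.
   Context: A free factor system of $G$ is a tuple $(H_1,\dots,H_k)$ of subgroups for which there is a free subgroup $F<G$ with $G=H_1*\dots*H_k*F$. An automorphism preserves it if it permutes the set of conjugacy classes $\{[H_1],\dots,[H_k]\}$. A free factor system $(J_1,\dots,J_\ell)$ is strictly larger than $(H_1,\dots,H_k)$ if each $H_i$ is conjugate into some $J_s$ and the two systems do not have the same set of conjugacy classes of nontrivial members; it is proper if no $J_s$ equals $G$. An automorphism $\phi$ preserving $(H_1,\dots,H_k)$ is fully irreducible relative to it if no positive power of $\phi$ preserves a proper free factor system that is strictly larger than $(H_1,\dots,H_k)$. It is atoroidal relative to it if for every $g\in G$ not contained in any conjugate of any $H_i$ and every integer $n\ge1$, $\phi^n(g)$ is not conjugate to $g$ in $G$. It has no twinned subgroups if for any two distinct subgroups $H\ne K$ of $G$, each conjugate to some $H_i$, any $g\in G$ and any integer $m\ge1$, $\phi^m(K)=gKg^{-1}$ implies $\phi^m(H)\ne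 gHg^{-1}$. The mapping torus is $\Gamma=G\rtimes_\phi\mathbb Z=\langle G,t\mid t^{-1}gt=\phi(g),\ g\in G\rangle$. *)

theory Defs
  imports "HOL-Analysis.Analysis" "HOL-Algebra.Generated_Groups" "HOL-Algebra.Group_Action" "HOL-Algebra.Module"
begin

section \<open>Groups, free groups and free products\<close>

definition finitely_generated :: "('a, 'b) monoid_scheme \<Rightarrow> bool" where
  "finitely_generated G \<longleftrightarrow> (\<exists>S. finite S \<and> S \<subseteq> carrier G \<and> generate G S = carrier G)"

definition torsion_free :: "('a, 'b) monoid_scheme \<Rightarrow> bool" where
  "torsion_free G \<longleftrightarrow>
     (\<forall>x\<in>carrier G. \<forall>n::nat. n \<ge> 1 \<longrightarrow> x [^]\<^bsub>G\<^esub> n = \<one>\<^bsub>G\<^esub> \<longrightarrow> x = \<one>\<^bsub>G\<^esub>)"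

definition word_product :: "('a, 'b) monoid_scheme \<Rightarrow> 'a list \<Rightarrow> 'a" where
  "word_product G ws = foldr (\<otimes>\<^bsub>G\<^esub>) ws \<one>\<^bsub>G\<^esub>"

text \<open>A letter \<open>(x, True)\<close> stands for \<open>x\<close> and \<open>(x, False)\<close> for its inverse. The reduced words are
  the elements of the free group on \<open>B\<close>.\<close>

definition free_words :: "'a set \<Rightarrow> ('a \<times> bool) list set" where
  "free_words B = {ws. set ws \<subseteq> B \<times> UNIV \<and>
     successively (\<lambda>(x, b) (y, c). \<not> (x = y \<and> b \<noteq> c)) ws}"

definition free_letter :: "('a, 'b) monoid_scheme \<Rightarrow> 'a \<times> bool \<Rightarrow> 'a" where
  "free_letter G = (\<lambda>(x, b). if b then x else inv\<^bsub>G\<^esub> x)"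

definition free_basis :: "('a, 'b) monoid_scheme \<Rightarrow> 'a set \<Rightarrow> 'a set \<Rightarrow> bool" where
  "free_basis G F B \<longleftrightarrow> subgroup F G \<and> B \<subseteq> F \<and>
     bij_betw (\<lambda>ws. word_product G (map (free_letter G) ws)) (free_words B) F"

definition free_subgroup :: "('a, 'b) monoid_scheme \<Rightarrow> 'a set \<Rightarrow> bool" where
  "free_subgroup G F \<longleftrightarrow> (\<exists>B. free_basis G F B)"

definition free_subgroup_of_rank :: "('a, 'b) monoid_scheme \<Rightarrow> 'a set \<Rightarrow> nat \<Rightarrow> bool" where
  "free_subgroup_of_rank G F r \<longleftrightarrow> (\<exists>B. free_basis G F B \<and> finite B \<and> card B = r)"

text \<open>The elements of the external free product of the subgroups \<open>Ks ! i\<close>: words whose letters are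
  nontrivial elements of the factors, tagged with the index of the factor, with neighbouring letters
  from factors of different index. The group is the internal free product of the list if the
  canonical map from the external one is bijective.\<close>

definition free_product_words ::
  "('a, 'b) monoid_scheme \<Rightarrow> 'a set list \<Rightarrow> (nat \<times> 'a) list set" where
  "free_product_words G Ks = {ws.
     (\<forall>(i, h)\<in>set ws. i < length Ks \<and> h \<in> Ks ! i \<and> h \<noteq> \<one>\<^bsub>G\<^esub>) \<and>
     successively (\<lambda>(i, _) (j, _). i \<noteq> j) ws}"

definition is_free_product :: "('a, 'b) monoid_scheme \<Rightarrow> 'a set list \<Rightarrow> bool" where
  "is_free_product G Ks \<longleftrightarrow> (\<forall>K\<in>set Ks. subgroup K G) \<and>
     bij_betw (\<lambda>ws. word_product G (map snd ws)) (free_product_words G Ks) (carrier G)"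


section \<open>Free factor systems\<close>

definition conj_subgroup :: "('a, 'b) monoid_scheme \<Rightarrow> 'a \<Rightarrow> 'a set \<Rightarrow> 'a set" where
  "conj_subgroup G g H = g <#\<^bsub>G\<^esub> H #>\<^bsub>G\<^esub> inv\<^bsub>G\<^esub> g"

definition conj_class :: "('a, 'b) monoid_scheme \<Rightarrow> 'a set \<Rightarrow> 'a set set" where
  "conj_class G H = (\<lambda>g. conj_subgroup G g H) ` carrier G"

definition free_factor_system :: "('a, 'b) monoid_scheme \<Rightarrow> 'a set list \<Rightarrow> bool" where
  "free_factor_system G Hs \<longleftrightarrow> (\<exists>F. free_subgroup G F \<and> is_free_product G (Hs @ [F]))"

definition preserves_system ::
  "('a, 'b) monoid_scheme \<Rightarrow> ('a \<Rightarrow> 'a) \<Rightarrow> 'a set list \<Rightarrow> bool" where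
  "preserves_system G \<phi> Hs \<longleftrightarrow>
     bij_betw (\<lambda>C. (\<lambda>K. \<phi> ` K) ` C) (conj_class G ` set Hs) (conj_class G ` set Hs)"

definition nontrivial_classes :: "('a, 'b) monoid_scheme \<Rightarrow> 'a set list \<Rightarrow> 'a set set set" where
  "nontrivial_classes G Hs = conj_class G ` {H \<in> set Hs. H \<noteq> {\<one>\<^bsub>G\<^esub>}}"

definition strictly_larger_system ::
  "('a, 'b) monoid_scheme \<Rightarrow> 'a set list \<Rightarrow> 'a set list \<Rightarrow> bool" where
  "strictly_larger_system G Js Hs \<longleftrightarrow>
     (\<forall>H\<in>set Hs. \<exists>J\<in>set Js. \<exists>g\<in>carrier G. conj_subgroup G g H \<subseteq> J) \<and>
     nontrivial_classes G Js \<noteq> nontrivial_classes G Hs"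

definition proper_system :: "('a, 'b) monoid_scheme \<Rightarrow> 'a set list \<Rightarrow> bool" where
  "proper_system G Js \<longleftrightarrow> carrier G \<notin> set Js"


section \<open>Properties of automorphisms\<close>

definition fully_irreducible ::
  "('a, 'b) monoid_scheme \<Rightarrow> 'a set list \<Rightarrow> ('a \<Rightarrow> 'a) \<Rightarrow> bool" where
  "fully_irreducible G Hs \<phi> \<longleftrightarrow>
     \<not> (\<exists>n\<ge>1::nat. \<exists>Js. free_factor_system G Js \<and> proper_system G Js \<and>
           strictly_larger_system G Js Hs \<and>
           preserves_system G (\<phi> [^]\<^bsub>AutoGroup G\<^esub> n) Js)"

text \<open>The condition \<open>g \<noteq> \<one>\<close> is implied by the following one unless the system is empty. For the empty
  system it yields the usual notion of an atoroidal automorphism of a free group, which no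
  automorphism would satisfy if \<open>g = \<one>\<close> were admitted.\<close>

definition atoroidal :: "('a, 'b) monoid_scheme \<Rightarrow> 'a set list \<Rightarrow> ('a \<Rightarrow> 'a) \<Rightarrow> bool" where
  "atoroidal G Hs \<phi> \<longleftrightarrow>
     (\<forall>g\<in>carrier G. g \<noteq> \<one>\<^bsub>G\<^esub> \<longrightarrow>
        (\<forall>H\<in>set Hs. \<forall>x\<in>carrier G. g \<notin> conj_subgroup G x H) \<longrightarrow>
        (\<forall>n\<ge>1::nat. \<not> (\<exists>x\<in>carrier G.
            (\<phi> [^]\<^bsub>AutoGroup G\<^esub> n) g = x \<otimes>\<^bsub>G\<^esub> g \<otimes>\<^bsub>G\<^esub> inv\<^bsub>G\<^esub> x)))"

definition no_twinned_subgroups ::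
  "('a, 'b) monoid_scheme \<Rightarrow> 'a set list \<Rightarrow> ('a \<Rightarrow> 'a) \<Rightarrow> bool" where
  "no_twinned_subgroups G Hs \<phi> \<longleftrightarrow>
     (\<forall>H \<in> \<Union>(conj_class G ` set Hs). \<forall>K \<in> \<Union>(conj_class G ` set Hs). H \<noteq> K \<longrightarrow>
        (\<forall>g\<in>carrier G. \<forall>m\<ge>1::nat.
           (\<phi> [^]\<^bsub>AutoGroup G\<^esub> m) ` K = conj_subgroup G g K \<longrightarrow>
           (\<phi> [^]\<^bsub>AutoGroup G\<^esub> m) ` H \<noteq> conj_subgroup G g H))"


section \<open>The mapping torus\<close>

text \<open>The pair \<open>(g, n)\<close> stands for \<open>g t\<^sup>n\<close>, where \<open>t\<inverse> g t = \<phi> g\<close>; hence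
  \<open>g t\<^sup>m h t\<^sup>n = g \<phi>\<^sup>-\<^sup>m(h) t\<^sup>m\<^sup>+\<^sup>n\<close>.\<close>

definition mapping_torus ::
  "('a, 'b) monoid_scheme \<Rightarrow> ('a \<Rightarrow> 'a) \<Rightarrow> ('a \<times> int) monoid" where
  "mapping_torus G \<phi> =
     \<lparr>carrier = carrier G \<times> UNIV,
      mult = (\<lambda>(g, m) (h, n). (g \<otimes>\<^bsub>G\<^esub> (\<phi> [^]\<^bsub>AutoGroup G\<^esub> (- m)) h, m + n)),
      one = (\<one>\<^bsub>G\<^esub>, 0)\<rparr>"

lemma auto_int_pow_apply_add:
  assumes "group G" "\<phi> \<in> auto G" "x \<in> carrier G"
  shows "(\<phi> [^]\<^bsub>AutoGroup G\<^esub> (m + n :: int)) x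
    = (\<phi> [^]\<^bsub>AutoGroup G\<^esub> m) ((\<phi> [^]\<^bsub>AutoGroup G\<^esub> n) x)"
proof -
  interpret A: group "AutoGroup G" using assms(1) by (rule group.AutoGroup)
  have c: "carrier (AutoGroup G) = auto G" by (simp add: AutoGroup_def)
  have p: "\<phi> [^]\<^bsub>AutoGroup G\<^esub> (k::int) \<in> auto G" for k
    using A.int_pow_closed[of \<phi> k] assms(2) c by simp
  have "\<phi> [^]\<^bsub>AutoGroup G\<^esub> (m + n) = \<phi> [^]\<^bsub>AutoGroup G\<^esub> m \<otimes>\<^bsub>AutoGroup G\<^esub> \<phi> [^]\<^bsub>AutoGroup G\<^esub> n"
    using assms(2) c by (simp add: A.int_pow_mult)
  then show ?thesis
    using p[of m] p[of n] assms(3) by (simp add: AutoGroup_def BijGroup_def auto_def compose_def)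
qed

lemma auto_int_pow_in_auto:
  assumes "group G" "\<phi> \<in> auto G"
  shows "\<phi> [^]\<^bsub>AutoGroup G\<^esub> (n :: int) \<in> auto G"
  using group.int_pow_closed[OF group.AutoGroup[OF assms(1)], of \<phi> n] assms(2)
  by (simp add: AutoGroup_def)

lemma group_mapping_torus:
  assumes G: "group G" and phi: "\<phi> \<in> auto G"
  shows "group (mapping_torus G \<phi>)"
proof -
  interpret G: group G by (rule G)
  let ?p = "\<lambda>n::int. \<phi> [^]\<^bsub>AutoGroup G\<^esub> n"
  have hom: "?p n \<in> hom G G" for n
    using auto_int_pow_in_auto[OF G phi, of n] by (simp add: auto_def)
  have cl: "?p n x \<in> carrier G" if "x \<in> carrier G" for n x
    using hom[of n] that by (auto simp: hom_def)
  have mul: "?p n (x \<otimes>\<^bsub>G\<^esub> y) = ?p n x \<otimes>\<^bsub>G\<^esub> ?p n y" if "x \<in> carrier G" "y \<in> carrier G" for n x y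
    using hom[of n] that by (auto simp: hom_def)
  have one: "?p n \<one>\<^bsub>G\<^esub> = \<one>\<^bsub>G\<^esub>" for n
    using hom[of n] G by (metis group.is_group hom_one)
  have zero: "\<one>\<^bsub>AutoGroup G\<^esub> x = x" if "x \<in> carrier G" for x
    using that by (simp add: AutoGroup_def BijGroup_def)
  note add = auto_int_pow_apply_add[OF G phi]
  show ?thesis
  proof (rule groupI)
    fix x assume "x \<in> carrier (mapping_torus G \<phi>)"
    then obtain g m where x: "x = (g, m)" "g \<in> carrier G" by (auto simp: mapping_torus_def)
    have "(inv\<^bsub>G\<^esub> (?p m g), - m) \<otimes>\<^bsub>mapping_torus G \<phi>\<^esub> x = \<one>\<^bsub>mapping_torus G \<phi>\<^esub>"
      using x by (simp add: mapping_torus_def cl)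
    then show "\<exists>y\<in>carrier (mapping_torus G \<phi>).
        y \<otimes>\<^bsub>mapping_torus G \<phi>\<^esub> x = \<one>\<^bsub>mapping_torus G \<phi>\<^esub>"
      using x by (intro bexI[of _ "(inv\<^bsub>G\<^esub> (?p m g), - m)"]) (auto simp: mapping_torus_def cl)
  next
    fix x y z
    assume "x \<in> carrier (mapping_torus G \<phi>)" "y \<in> carrier (mapping_torus G \<phi>)"
      "z \<in> carrier (mapping_torus G \<phi>)"
    then obtain a k b m c n where xyz: "x = (a, k)" "y = (b, m)" "z = (c, n)"
      "a \<in> carrier G" "b \<in> carrier G" "c \<in> carrier G"
      by (auto simp: mapping_torus_def)
    have "?p (- k - m) c = ?p (- k) (?p (- m) c)"
      using add[of c "- k" "- m"] xyz by simp
    then show "x \<otimes>\<^bsub>mapping_torus G \<phi>\<^esub> y \<otimes>\<^bsub>mapping_torus G \<phi>\<^esub> z =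
        x \<otimes>\<^bsub>mapping_torus G \<phi>\<^esub> (y \<otimes>\<^bsub>mapping_torus G \<phi>\<^esub> z)"
      using xyz by (simp add: mapping_torus_def cl mul G.m_assoc)
  qed (auto simp: mapping_torus_def cl zero)
qed

lemma mapping_torus_relation:
  assumes G: "group G" and phi: "\<phi> \<in> auto G" and g: "g \<in> carrier G"
  shows "inv\<^bsub>mapping_torus G \<phi>\<^esub> (\<one>\<^bsub>G\<^esub>, 1) \<otimes>\<^bsub>mapping_torus G \<phi>\<^esub> (g, 0)
      \<otimes>\<^bsub>mapping_torus G \<phi>\<^esub> (\<one>\<^bsub>G\<^esub>, 1) = (\<phi> g, 0)"
proof -
  interpret G: group G by (rule G)
  interpret T: group "mapping_torus G \<phi>" by (rule group_mapping_torus[OF G phi])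
  interpret A: group "AutoGroup G" by (rule group.AutoGroup[OF G])
  let ?p = "\<lambda>n::int. \<phi> [^]\<^bsub>AutoGroup G\<^esub> n"
  have hom: "?p n \<in> hom G G" for n
    using auto_int_pow_in_auto[OF G phi, of n] by (simp add: auto_def)
  have one: "?p n \<one>\<^bsub>G\<^esub> = \<one>\<^bsub>G\<^esub>" for n
    using hom[of n] G by (metis group.is_group hom_one)
  have p1: "?p 1 = \<phi>"
    using A.int_pow_1[of \<phi>] phi by (simp add: AutoGroup_def)
  have "inv\<^bsub>mapping_torus G \<phi>\<^esub> (\<one>\<^bsub>G\<^esub>, 1) = (\<one>\<^bsub>G\<^esub>, - 1)"
    by (rule T.inv_equality) (auto simp: mapping_torus_def one)
  moreover have "\<phi> g \<in> carrier G"
    using phi g by (auto simp: auto_def hom_def)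
  ultimately show ?thesis
    using g p1 one[of 1] by (simp add: mapping_torus_def one)
qed


section \<open>Affine isometric actions on Hilbert spaces\<close>

text \<open>Hilbert spaces are set-based structures rather than types of class \<open>real_inner\<close>, so that
  they can be quantified existentially; only the type of the vectors has to be fixed. For a group
  \<open>\<Gamma>\<close> with elements of type \<open>'g\<close>, the type \<open>'g \<Rightarrow> real\<close> is large enough: given an affine isometric action
  of \<open>\<Gamma>\<close> on any Hilbert space, the closed linear span of the orbit of \<open>0\<close> is invariant, and its vectors
  \<open>v\<close> are determined by the functions \<open>\<gamma> \<mapsto> \<langle>v, \<gamma> 0\<rangle>\<close>. If all orbits are unbounded, or a subgroup fixes
  no point, this remains true on that subspace. The operations and the inner product of a structure
  with vectors of this type are arbitrary; they need not be pointwise.\<close>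

definition real_ring :: "real ring" where
  "real_ring = \<lparr>carrier = UNIV, mult = (*), one = 1, zero = 0, add = (+)\<rparr>"

record 'v inner_product_space = "(real, 'v) module" +
  ip :: "'v \<Rightarrow> 'v \<Rightarrow> real"

definition hdist :: "('v, 'b) inner_product_space_scheme \<Rightarrow> 'v \<Rightarrow> 'v \<Rightarrow> real" where
  "hdist V x y = sqrt (ip V (x \<ominus>\<^bsub>V\<^esub> y) (x \<ominus>\<^bsub>V\<^esub> y))"

locale hilbert_space =
  fixes V :: "('v, 'b) inner_product_space_scheme" (structure)
  assumes module: "Module.module real_ring V"
    and ip_commute: "\<lbrakk>x \<in> carrier V; y \<in> carrier V\<rbrakk> \<Longrightarrow> ip V x y = ip V y x"
    and ip_add_left: "\<lbrakk>x \<in> carrier V; y \<in> carrier V; z \<in> carrier V\<rbrakk>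
          \<Longrightarrow> ip V (x \<oplus> y) z = ip V x z + ip V y z"
    and ip_scale_left: "\<lbrakk>x \<in> carrier V; y \<in> carrier V\<rbrakk> \<Longrightarrow> ip V (c \<odot> x) y = c * ip V x y"
    and ip_pos: "\<lbrakk>x \<in> carrier V; x \<noteq> \<zero>\<rbrakk> \<Longrightarrow> ip V x x > 0"
    and complete: "Metric_space.mcomplete (carrier V) (hdist V)"

lemma hilbert_space_UNIV:
  "hilbert_space \<lparr>carrier = (UNIV :: 'h::{real_inner, complete_space} set), mult = undefined,
     one = undefined, zero = 0, add = (+), smult = (*\<^sub>R), ip = (\<bullet>)\<rparr>" (is "hilbert_space ?V")
proof -
  have ab: "abelian_group ?V"
    by (rule abelian_groupI) (auto intro: exI[of _ "- x" for x] simp: algebra_simps)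
  then interpret A: abelian_group ?V .
  have cr: "cring real_ring"
    by (rule cringI; (rule abelian_groupI | rule comm_monoidI)?)
      (auto simp: real_ring_def algebra_simps intro: exI[of _ "- x" for x])
  have mod: "Module.module real_ring ?V"
    by (rule Module.moduleI[OF cr ab]) (auto simp: real_ring_def algebra_simps)
  have "\<ominus>\<^bsub>?V\<^esub> y = - y" for y
    by (rule A.minus_equality) auto
  then have d: "hdist ?V = dist"
    by (auto simp: fun_eq_iff hdist_def a_minus_def dist_norm norm_eq_sqrt_inner)
  have "Metric_space.mcomplete UNIV (dist :: 'h \<Rightarrow> 'h \<Rightarrow> real)"
    by (simp add: mcomplete_iff_complete complete_UNIV)
  then show ?thesis
    by (intro hilbert_space.intro) (use mod d in \<open>auto simp: inner_commute inner_add_right\<close>)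
qed

definition linear_isometry ::
  "('v, 'b) inner_product_space_scheme \<Rightarrow> ('v \<Rightarrow> 'v) \<Rightarrow> bool" where
  "linear_isometry V U \<longleftrightarrow> U \<in> carrier V \<rightarrow> carrier V \<and>
     (\<forall>x\<in>carrier V. \<forall>y\<in>carrier V. U (x \<oplus>\<^bsub>V\<^esub> y) = U x \<oplus>\<^bsub>V\<^esub> U y) \<and>
     (\<forall>c. \<forall>x\<in>carrier V. U (c \<odot>\<^bsub>V\<^esub> x) = c \<odot>\<^bsub>V\<^esub> U x) \<and>
     (\<forall>x\<in>carrier V. \<forall>y\<in>carrier V. ip V (U x) (U y) = ip V x y)"

definition affine_isometry ::
  "('v, 'b) inner_product_space_scheme \<Rightarrow> ('v \<Rightarrow> 'v) \<Rightarrow> bool" where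
  "affine_isometry V f \<longleftrightarrow>
     (\<exists>U. \<exists>b\<in>carrier V. linear_isometry V U \<and> (\<forall>x\<in>carrier V. f x = U x \<oplus>\<^bsub>V\<^esub> b))"

definition affine_isometric_action ::
  "('g, 'c) monoid_scheme \<Rightarrow> ('v, 'b) inner_product_space_scheme \<Rightarrow> ('g \<Rightarrow> 'v \<Rightarrow> 'v) \<Rightarrow> bool" where
  "affine_isometric_action \<Gamma> V \<alpha> \<longleftrightarrow>
     group_action \<Gamma> (carrier V) \<alpha> \<and> (\<forall>\<gamma>\<in>carrier \<Gamma>. affine_isometry V (\<alpha> \<gamma>))"

definition unbounded_orbits ::
  "('g, 'c) monoid_scheme \<Rightarrow> ('v, 'b) inner_product_space_scheme \<Rightarrow> ('g \<Rightarrow> 'v \<Rightarrow> 'v) \<Rightarrow> bool" where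
  "unbounded_orbits \<Gamma> V \<alpha> \<longleftrightarrow>
     (\<forall>x\<in>carrier V. \<not> Metric_space.mbounded (carrier V) (hdist V) (Group_Action.orbit \<Gamma> \<alpha> x))"

end

theory Submission
  imports Defs "HOL-Library.FSet"
begin

text \<open>The mapping torus \<open>\<Gamma>\<close> of \<open>\<phi>\<close> inherits the desired action from an unbounded action of \<open>G\<close> itself on a
  Hilbert space; this rests on three facts.

  A free product has a natural unbounded action. The set \<open>X\<close> of elements whose normal form ends in a
  given factor (or, in a free group, in a given basis letter) is commensurated: it differs from each
  left translate \<open>gX\<close> in finitely many elements, since multiplication on the left
  changes the kind of the last letter of only finitely many normal forms. The number \<open>l(g)\<close> of elements of the symmetric difference of
  \<open>X\<close> and \<open>gX\<close> is a length function on \<open>G\<close>, and it is unbounded (\<open>unbounded_commensurated_set\<close>).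

  For \<open>0 < q < 1\<close> there is an orthogonal representation of \<open>G\<close> with a unit vector \<open>v\<close> such that
  \<open>\<langle>v, gv\<rangle> = q\<^sup>l\<^sup>(\<^sup>g\<^sup>)\<close>. Attach independent random signs of mean \<open>q\<close> to the points; then \<open>G\<close> permutes
  the signs, and this action is twisted by the product of the signs in the symmetric difference of \<open>X\<close>
  and \<open>gX\<close>. In a suitable orthonormal basis all of this takes place in a space of square-summable
  functions, with explicit operators (\<open>fock_mult\<close>, \<open>fock_vacuum\<close>). As \<open>q\<close> tends to \<open>1\<close>, a given \<open>g\<close>
  moves \<open>v\<close> less and less, but for every \<open>q\<close> there are elements that move \<open>v\<close> to an almost
  orthogonal vector.

  Finally, the group \<open>\<int>\<close> is amenable. In the representation of \<open>\<Gamma>\<close> induced from the one of \<open>G\<close>, take the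
  copies of \<open>v\<close> at the positions \<open>0 \<le> j < 8\<^sup>N\<close>, scaled by \<open>2\<^sup>-\<^sup>N\<close>, with a parameter \<open>q\<^sub>N\<close> very close
  to \<open>1\<close>. The stable letter moves this vector only at the two ends of the window, hence by a square
  distance that is summable over \<open>N\<close>. An element \<open>g\<close> of \<open>G\<close> acts at the position \<open>j\<close> as \<open>\<phi>\<^sup>j(g)\<close>; since
  \<open>G\<close> is countable, \<open>q\<^sub>N\<close> can be chosen so that each \<open>g\<close> moves the vector by a summable square
  distance, too. So the sum \<open>f\<close> of these vectors over all \<open>N\<close>, although it is not square-summable, gives
  rise to the affine isometric action \<open>\<xi> \<mapsto> \<gamma>(\<xi> + f) - f\<close> (\<open>square_summable_displacement\<close>). On the
  other hand, the finitely many unbounded length functions \<open>l(\<phi>\<^sup>j(g))\<close> are large for a common \<open>g\<close>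
  (\<open>simultaneously_long\<close>), and such an element moves the \<open>N\<close>-th vector by a square distance of at least
  \<open>2\<^sup>N\<close>. Therefore \<open>G\<close> has unbounded orbits, and so it has no fixed point.\<close>


section \<open>The Hilbert space of square-summable functions\<close>

typedef 'i ell2 = "{v :: 'i \<Rightarrow> real. (\<lambda>i. (v i)\<^sup>2) summable_on UNIV}"
  morphisms coord Ell2
  by (rule exI[of _ "\<lambda>_. 0"]) simp

abbreviation square_summable :: "('i \<Rightarrow> real) \<Rightarrow> bool" where
  "square_summable v \<equiv> (\<lambda>i. (v i)\<^sup>2) summable_on UNIV"

lemma square_summable_coord: "square_summable (coord x)"
  using coord[of x] by simp

lemma coord_Ell2: "square_summable v \<Longrightarrow> coord (Ell2 v) = v"
  by (simp add: Ell2_inverse)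

lemma ell2_eqI: "(\<And>i. coord x i = coord y i) \<Longrightarrow> x = y"
  by (metis coord_inject ext)

lemma square_summable_scale:
  assumes "square_summable v"
  shows "square_summable (\<lambda>i. c * v i)"
  using summable_on_cmult_right[OF assms, of "c\<^sup>2"] by (simp add: power_mult_distrib)

lemma square_summable_add:
  assumes "square_summable v" "square_summable w"
  shows "square_summable (\<lambda>i. v i + w i)"
proof (rule summable_on_comparison_test)
  show "(\<lambda>i. 2 * (v i)\<^sup>2 + 2 * (w i)\<^sup>2) summable_on UNIV"
    using assms by (intro summable_on_add summable_on_cmult_right)
  fix i
  have "0 \<le> (v i - w i)\<^sup>2" by simp
  then show "(v i + w i)\<^sup>2 \<le> 2 * (v i)\<^sup>2 + 2 * (w i)\<^sup>2"
    by (simp add: power2_eq_square algebra_simps)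
qed simp

lemma square_summable_diff:
  assumes "square_summable v" "square_summable w"
  shows "square_summable (\<lambda>i. v i - w i)"
  using square_summable_add[OF assms(1) square_summable_scale[OF assms(2), of "- 1"]] by simp

lemma square_summable_times:
  assumes "square_summable v" "square_summable w"
  shows "(\<lambda>i. v i * w i) summable_on UNIV"
proof -
  have eq: "v i * w i = 1/2 * (v i + w i)\<^sup>2 + (- 1/2 * (v i)\<^sup>2 + - 1/2 * (w i)\<^sup>2)" for i
    by (simp add: power2_eq_square algebra_simps)
  show ?thesis
    unfolding eq using assms square_summable_add[OF assms]
    by (intro summable_on_add summable_on_cmult_right)
qed

instantiation ell2 :: (type) real_vector
begin

definition "0 = Ell2 (\<lambda>_. 0)"
definition "x + y = Ell2 (\<lambda>i. coord x i + coord y i)"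
definition "x - y = Ell2 (\<lambda>i. coord x i - coord y i)"
definition "- x = Ell2 (\<lambda>i. - coord x i)"
definition "c *\<^sub>R x = Ell2 (\<lambda>i. c * coord x i)"

lemma coord_zero: "coord 0 i = 0"
  by (simp add: zero_ell2_def coord_Ell2)

lemma coord_add: "coord (x + y) i = coord x i + coord y i"
  by (simp add: plus_ell2_def coord_Ell2 square_summable_add square_summable_coord)

lemma coord_diff: "coord (x - y) i = coord x i - coord y i"
  by (simp add: minus_ell2_def coord_Ell2 square_summable_diff square_summable_coord)

lemma coord_uminus: "coord (- x) i = - coord x i"
  by (simp add: uminus_ell2_def coord_Ell2 square_summable_coord)

lemma coord_scaleR: "coord (c *\<^sub>R x) i = c * coord x i"
  by (simp add: scaleR_ell2_def coord_Ell2 square_summable_scale square_summable_coord)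

instance
  by standard (auto intro!: ell2_eqI
      simp: coord_zero coord_add coord_diff coord_uminus coord_scaleR algebra_simps)

end

instantiation ell2 :: (type) real_inner
begin

definition "inner x y = (\<Sum>\<^sub>\<infinity>i. coord x i * coord y i)"
definition "norm (x :: 'a ell2) = sqrt (inner x x)"
definition "dist (x :: 'a ell2) y = norm (x - y)"
definition "sgn (x :: 'a ell2) = x /\<^sub>R norm x"
definition "uniformity = (INF e\<in>{0 <..}. principal {(x :: 'a ell2, y). dist x y < e})"
definition "open (U :: 'a ell2 set) \<longleftrightarrow>
  (\<forall>x\<in>U. \<forall>\<^sub>F (x', y) in uniformity. x' = x \<longrightarrow> y \<in> U)"

instance
proof
  note times = square_summable_times[OF square_summable_coord square_summable_coord]
  fix x y z :: "'a ell2" and c :: real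
  show "inner x y = inner y x" by (simp add: inner_ell2_def mult.commute)
  show "inner (x + y) z = inner x z + inner y z"
    by (simp add: inner_ell2_def coord_add distrib_right infsum_add times)
  show "inner (c *\<^sub>R x) y = c * inner x y"
    by (simp add: inner_ell2_def coord_scaleR mult.assoc infsum_cmult_right times)
  show "0 \<le> inner x x" by (simp add: inner_ell2_def infsum_nonneg)
  show "inner x x = 0 \<longleftrightarrow> x = 0"
  proof
    assume "inner x x = 0"
    then have "coord x i * coord x i = 0" for i
      using nonneg_infsum_le_0D[of "\<lambda>i. coord x i * coord x i" UNIV i] times[of x x]
      by (simp add: inner_ell2_def)
    then show "x = 0" by (intro ell2_eqI) (simp add: coord_zero)
  qed (simp add: inner_ell2_def coord_zero)
qed (auto simp: norm_ell2_def dist_ell2_def sgn_ell2_def uniformity_ell2_def open_ell2_def)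

end

lemma norm_square_ell2: "(norm (x :: 'i ell2))\<^sup>2 = (\<Sum>\<^sub>\<infinity>i. (coord x i)\<^sup>2)"
  unfolding power2_norm_eq_inner inner_ell2_def by (simp add: power2_eq_square)

lemma has_sum_norm_square: "((\<lambda>i. (coord x i)\<^sup>2) has_sum (norm x)\<^sup>2) UNIV"
  by (simp add: norm_square_ell2 square_summable_coord)

lemma finite_sum_le_norm_square:
  assumes "finite I"
  shows "(\<Sum>i\<in>I. (coord x i)\<^sup>2) \<le> (norm x)\<^sup>2"
  unfolding norm_square_ell2
  by (rule finite_sum_le_infsum) (use assms square_summable_coord in auto)

lemma abs_coord_le_norm: "\<bar>coord x i\<bar> \<le> norm x"
  using finite_sum_le_norm_square[of "{i}" x] by (simp add: abs_le_square_iff[symmetric])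

lemma has_sum_norm_square_Ell2:
  assumes "((\<lambda>i. (v i)\<^sup>2) has_sum s) UNIV"
  shows "coord (Ell2 v) = v" "(norm (Ell2 v))\<^sup>2 = s"
proof -
  show c: "coord (Ell2 v) = v"
    using assms has_sum_imp_summable by (intro coord_Ell2) blast
  show "(norm (Ell2 v))\<^sup>2 = s"
    unfolding norm_square_ell2 c using assms by (rule infsumI)
qed

instance ell2 :: (type) complete_space
proof
  (* The limit is the coordinatewise one, to which the bounds on finite partial sums pass. *)
  fix X :: "nat \<Rightarrow> 'a ell2"
  assume X: "Cauchy X"
  have "Cauchy (\<lambda>n. coord (X n) i)" for i
  proof (rule metric_CauchyI)
    fix e :: real assume "e > 0"
    then obtain M where M: "\<And>m n. m \<ge> M \<Longrightarrow> n \<ge> M \<Longrightarrow> dist (X m) (X n) < e"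
      using metric_CauchyD[OF X] by blast
    have "dist (coord (X m) i) (coord (X n) i) \<le> dist (X m) (X n)" for m n
      using abs_coord_le_norm[of "X m - X n" i]
      by (simp add: dist_ell2_def coord_diff dist_real_def)
    then show "\<exists>M. \<forall>m\<ge>M. \<forall>n\<ge>M. dist (coord (X m) i) (coord (X n) i) < e"
      using M by (blast intro: le_less_trans)
  qed
  then have "\<forall>i. \<exists>l. (\<lambda>n. coord (X n) i) \<longlonglongrightarrow> l"
    using Cauchy_convergent unfolding convergent_def by blast
  then obtain v where v: "\<And>i. (\<lambda>n. coord (X n) i) \<longlonglongrightarrow> v i"
    by metis
  have tail: "\<exists>M. \<forall>m\<ge>M. square_summable (\<lambda>i. coord (X m) i - v i) \<and>
      (\<Sum>\<^sub>\<infinity>i. (coord (X m) i - v i)\<^sup>2) \<le> e\<^sup>2" if e: "e > 0" for e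
  proof -
    obtain M where M: "\<And>m n. m \<ge> M \<Longrightarrow> n \<ge> M \<Longrightarrow> norm (X m - X n) < e"
      using metric_CauchyD[OF X e] by (auto simp: dist_ell2_def)
    have fin: "(\<Sum>i\<in>F. (coord (X m) i - v i)\<^sup>2) \<le> e\<^sup>2" if F: "finite F" and m: "m \<ge> M" for F m
    proof (rule tendsto_upperbound)
      show "(\<lambda>n. \<Sum>i\<in>F. (coord (X m) i - coord (X n) i)\<^sup>2)
          \<longlonglongrightarrow> (\<Sum>i\<in>F. (coord (X m) i - v i)\<^sup>2)"
        by (intro tendsto_intros v)
      show "\<forall>\<^sub>F n in sequentially. (\<Sum>i\<in>F. (coord (X m) i - coord (X n) i)\<^sup>2) \<le> e\<^sup>2"
      proof (rule eventually_sequentiallyI)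
        fix n assume n: "M \<le> n"
        have "(\<Sum>i\<in>F. (coord (X m) i - coord (X n) i)\<^sup>2) \<le> (norm (X m - X n))\<^sup>2"
          using finite_sum_le_norm_square[OF F, of "X m - X n"] by (simp add: coord_diff)
        also have "\<dots> \<le> e\<^sup>2"
          using M[OF m n] by (intro power_mono) auto
        finally show "(\<Sum>i\<in>F. (coord (X m) i - coord (X n) i)\<^sup>2) \<le> e\<^sup>2" .
      qed
    qed simp
    have "square_summable (\<lambda>i. coord (X m) i - v i)" if "m \<ge> M" for m
      by (rule nonneg_bdd_above_summable_on) (use fin[OF _ that] in \<open>auto intro!: bdd_aboveI2\<close>)
    then show ?thesis
      using fin by (intro exI[of _ M]) (auto intro: infsum_le_finite_sums)
  qed
  obtain m where m: "square_summable (\<lambda>i. coord (X m) i - v i)"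
    using tail[of 1] by force
  have sv: "square_summable v"
    using square_summable_diff[OF square_summable_coord[of "X m"] m] by simp
  have "X \<longlonglongrightarrow> Ell2 v"
  proof (rule metric_LIMSEQ_I)
    fix e :: real assume e: "e > 0"
    obtain M where M: "\<And>m. m \<ge> M \<Longrightarrow> (\<Sum>\<^sub>\<infinity>i. (coord (X m) i - v i)\<^sup>2) \<le> (e/2)\<^sup>2"
      using tail[of "e/2"] e by auto
    have "dist (X n) (Ell2 v) < e" if "n \<ge> M" for n
    proof -
      have "(norm (X n - Ell2 v))\<^sup>2 \<le> (e/2)\<^sup>2"
        using M[OF that] by (simp add: norm_square_ell2 coord_diff coord_Ell2[OF sv])
      then have "norm (X n - Ell2 v) \<le> e/2"
        using e by (simp add: power2_le_iff_abs_le)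
      then show ?thesis using e by (simp add: dist_ell2_def)
    qed
    then show "\<exists>M. \<forall>n\<ge>M. dist (X n) (Ell2 v) < e" by blast
  qed
  then show "convergent X" by (rule convergentI)
qed


section \<open>Transporting affine isometric actions to a space of functions\<close>

abbreviation preimage :: "('h \<Rightarrow> 'v) \<Rightarrow> 'v \<Rightarrow> 'h" where
  "preimage T \<equiv> inv_into UNIV T"

text \<open>Off its carrier the structure computes through an arbitrary preimage. So the distance is
  a symmetric function on the whole type of vectors, as the notion of a metric on a subset demands.\<close>

definition hilbert_image :: "('h::real_inner \<Rightarrow> 'v) \<Rightarrow> 'v inner_product_space" where
  "hilbert_image T = \<lparr>carrier = range T, mult = undefined, one = undefined, zero = T 0,
     add = (\<lambda>x y. T (preimage T x + preimage T y)), smult = (\<lambda>c x. T (c *\<^sub>R preimage T x)),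
     ip = (\<lambda>x y. preimage T x \<bullet> preimage T y)\<rparr>"

lemma carrier_hilbert_image: "carrier (hilbert_image T) = range T"
  by (simp add: hilbert_image_def)

lemma abelian_group_hilbert_image:
  assumes "inj T"
  shows "abelian_group (hilbert_image T)"
proof (rule abelian_groupI)
  fix x assume "x \<in> carrier (hilbert_image T)"
  then show "\<exists>y\<in>carrier (hilbert_image T). y \<oplus>\<^bsub>hilbert_image T\<^esub> x = \<zero>\<^bsub>hilbert_image T\<^esub>"
    using assms by (intro bexI[of _ "T (- preimage T x)"]) (auto simp: hilbert_image_def)
qed (use assms in \<open>auto simp: hilbert_image_def add_ac\<close>)

text \<open>The negative of a vector outside the carrier is still determined: adding the vector amounts to
  adding its arbitrary preimage. Hence the formula for the distance holds on the whole type.\<close>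

lemma hdist_hilbert_image:
  assumes T: "inj T"
  shows "hdist (hilbert_image T) x y = dist (preimage T x) (preimage T y)"
proof -
  let ?V = "hilbert_image T"
  have "\<ominus>\<^bsub>?V\<^esub> y = T (- preimage T y)"
    unfolding a_inv_def m_inv_def
  proof (rule the_equality)
    fix z assume z: "z \<in> carrier (add_monoid ?V) \<and>
      y \<otimes>\<^bsub>add_monoid ?V\<^esub> z = \<one>\<^bsub>add_monoid ?V\<^esub> \<and> z \<otimes>\<^bsub>add_monoid ?V\<^esub> y = \<one>\<^bsub>add_monoid ?V\<^esub>"
    then obtain u where u: "z = T u" by (auto simp: hilbert_image_def)
    have "preimage T y + u = 0"
      using z T by (auto simp: hilbert_image_def u inj_eq)
    then show "z = T (- preimage T y)" by (metis u add.inverse_unique)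
  qed (use T in \<open>auto simp: hilbert_image_def\<close>)
  then show ?thesis
    using T by (simp add: hdist_def a_minus_def hilbert_image_def dist_norm norm_eq_sqrt_inner)
qed

lemma Metric_space_hilbert_image:
  assumes "inj T"
  shows "Metric_space (range T) (hdist (hilbert_image T))"
  using assms
  by unfold_locales (auto simp: hdist_hilbert_image dist_commute dist_triangle inj_eq)

lemma hilbert_space_hilbert_image:
  fixes T :: "'h::{real_inner, complete_space} \<Rightarrow> 'v"
  assumes T: "inj T"
  shows "hilbert_space (hilbert_image T)"
proof -
  let ?V = "hilbert_image T"
  interpret M: Metric_space "range T" "hdist ?V"
    by (rule Metric_space_hilbert_image[OF T])
  have cr: "cring real_ring"
    by (rule cringI; (rule abelian_groupI | rule comm_monoidI)?)
      (auto simp: real_ring_def algebra_simps intro: exI[of _ "- x" for x])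
  have mod: "Module.module real_ring ?V"
    by (rule Module.moduleI[OF cr abelian_group_hilbert_image[OF T]])
      (use T in \<open>auto simp: real_ring_def hilbert_image_def algebra_simps\<close>)
  have "M.mcomplete"
    unfolding M.mcomplete_def
  proof (intro allI impI)
    fix s assume s: "M.MCauchy s"
    then have "Cauchy (\<lambda>n. preimage T (s n))"
      by (auto simp: M.MCauchy_def Cauchy_def hdist_hilbert_image[OF T])
    then obtain l where l: "(\<lambda>n. preimage T (s n)) \<longlonglongrightarrow> l"
      using Cauchy_convergent unfolding convergent_def by blast
    have "limitin M.mtopology s (T l) sequentially"
      unfolding M.limit_metric_sequentially hdist_hilbert_image[OF T]
    proof (intro conjI allI impI)
      fix e :: real assume "e > 0"
      then obtain N where "\<forall>n\<ge>N. dist (preimage T (s n)) l < e"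
        using metric_LIMSEQ_D[OF l] by blast
      moreover have "s n \<in> range T" for n
        using s by (auto simp: M.MCauchy_def)
      ultimately show "\<exists>N. \<forall>n\<ge>N. s n \<in> range T \<and> dist (preimage T (s n)) (preimage T (T l)) < e"
        using T by auto
    qed simp
    then show "\<exists>x. limitin M.mtopology s x sequentially" ..
  qed
  then show ?thesis
    by (intro hilbert_space.intro)
      (use mod T in \<open>auto simp: hilbert_image_def inner_commute inner_add_right\<close>)
qed

lemma inner_eq_if_norm_eq:
  fixes L :: "'h::real_inner \<Rightarrow> 'h"
  assumes "linear L" "\<And>x. norm (L x) = norm x"
  shows "L x \<bullet> L y = x \<bullet> y"
  using assms(2)[of "x + y"] assms(2)[of x] assms(2)[of y]
  by (simp add: dot_norm linear_add[OF assms(1), symmetric])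

text \<open>The passage from a Hilbert space that is a type to one inside a prescribed type of vectors.
  Once a subset of the group moves every point arbitrarily far, the orbits are unbounded and
  that subset has no common fixed point.\<close>

lemma affine_isometric_action_on_image:
  fixes T :: "'h::{real_inner, complete_space} \<Rightarrow> 'v" and A :: "'g \<Rightarrow> 'h \<Rightarrow> 'h"
  assumes T: "inj T" and group: "group \<Gamma>"
    and one: "\<And>x. A \<one>\<^bsub>\<Gamma>\<^esub> x = x"
    and mult: "\<And>\<gamma> \<delta> x. \<gamma> \<in> carrier \<Gamma> \<Longrightarrow> \<delta> \<in> carrier \<Gamma> \<Longrightarrow> A (\<gamma> \<otimes>\<^bsub>\<Gamma>\<^esub> \<delta>) x = A \<gamma> (A \<delta> x)"
    and affine: "\<And>\<gamma> x. \<gamma> \<in> carrier \<Gamma> \<Longrightarrow> A \<gamma> x = L \<gamma> x + b \<gamma>"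
    and linear: "\<And>\<gamma>. \<gamma> \<in> carrier \<Gamma> \<Longrightarrow> linear (L \<gamma>)"
    and isometry: "\<And>\<gamma> x. \<gamma> \<in> carrier \<Gamma> \<Longrightarrow> norm (L \<gamma> x) = norm x"
    and S: "S \<subseteq> carrier \<Gamma>"
    and far: "\<And>x R. \<exists>\<gamma>\<in>S. dist (A \<gamma> x) x > R"
  shows "\<exists>(V :: 'v inner_product_space) \<alpha>. hilbert_space V \<and> affine_isometric_action \<Gamma> V \<alpha> \<and>
    unbounded_orbits \<Gamma> V \<alpha> \<and> \<not> (\<exists>x\<in>carrier V. \<forall>\<gamma>\<in>S. \<alpha> \<gamma> x = x)"
proof -
  interpret \<Gamma>: group \<Gamma> by (rule group)
  let ?V = "hilbert_image T"
  define \<alpha> where "\<alpha> = (\<lambda>\<gamma>. \<lambda>x\<in>range T. T (A \<gamma> (preimage T x)))"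
  interpret M: Metric_space "range T" "hdist ?V"
    by (rule Metric_space_hilbert_image[OF T])
  have \<alpha>T: "\<alpha> \<gamma> (T x) = T (A \<gamma> x)" for \<gamma> x
    using T by (simp add: \<alpha>_def)
  have inverse: "A (inv\<^bsub>\<Gamma>\<^esub> \<gamma>) (A \<gamma> x) = x" "A \<gamma> (A (inv\<^bsub>\<Gamma>\<^esub> \<gamma>) x) = x"
    if "\<gamma> \<in> carrier \<Gamma>" for \<gamma> x
    using that mult[of \<gamma> "inv\<^bsub>\<Gamma>\<^esub> \<gamma>" x] mult[of "inv\<^bsub>\<Gamma>\<^esub> \<gamma>" \<gamma> x] one by simp_all
  have bij: "\<alpha> \<gamma> \<in> Bij (range T)" if g: "\<gamma> \<in> carrier \<Gamma>" for \<gamma>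
  proof -
    have "bij_betw (\<alpha> \<gamma>) (range T) (range T)"
      by (rule bij_betwI[where g = "\<alpha> (inv\<^bsub>\<Gamma>\<^esub> \<gamma>)"]) (use inverse[OF g] in \<open>auto simp: \<alpha>T\<close>)
    then show ?thesis by (simp add: Bij_def \<alpha>_def)
  qed
  have "group_hom \<Gamma> (BijGroup (range T)) \<alpha>"
  proof (intro group_hom.intro group_hom_axioms.intro homI group group_BijGroup)
    fix \<gamma> \<delta> assume "\<gamma> \<in> carrier \<Gamma>" "\<delta> \<in> carrier \<Gamma>"
    then have "\<alpha> (\<gamma> \<otimes>\<^bsub>\<Gamma>\<^esub> \<delta>) = compose (range T) (\<alpha> \<gamma>) (\<alpha> \<delta>)"
      by (auto simp: fun_eq_iff compose_def \<alpha>T mult) (simp add: \<alpha>_def)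
    then show "\<alpha> (\<gamma> \<otimes>\<^bsub>\<Gamma>\<^esub> \<delta>) = \<alpha> \<gamma> \<otimes>\<^bsub>BijGroup (range T)\<^esub> \<alpha> \<delta>"
      using bij \<open>\<gamma> \<in> carrier \<Gamma>\<close> \<open>\<delta> \<in> carrier \<Gamma>\<close> by (simp add: BijGroup_def)
  qed (use bij in \<open>simp add: BijGroup_def\<close>)
  then have action: "group_action \<Gamma> (carrier ?V) \<alpha>"
    by (simp add: group_action_def carrier_hilbert_image)
  have "affine_isometry ?V (\<alpha> \<gamma>)" if g: "\<gamma> \<in> carrier \<Gamma>" for \<gamma>
    unfolding affine_isometry_def
  proof (intro exI bexI conjI)
    show "linear_isometry ?V (T \<circ> L \<gamma> \<circ> preimage T)"
      using T linear_add[OF linear[OF g]] linear_scale[OF linear[OF g]]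
        inner_eq_if_norm_eq[OF linear[OF g] isometry[OF g]]
      by (auto simp: linear_isometry_def hilbert_image_def)
    show "\<forall>x\<in>carrier ?V. \<alpha> \<gamma> x = (T \<circ> L \<gamma> \<circ> preimage T) x \<oplus>\<^bsub>?V\<^esub> T (b \<gamma>)"
      using T by (auto simp: hilbert_image_def \<alpha>T affine[OF g])
  qed (simp add: carrier_hilbert_image)
  with action have act: "affine_isometric_action \<Gamma> ?V \<alpha>"
    by (simp add: affine_isometric_action_def)
  have unb: "unbounded_orbits \<Gamma> ?V \<alpha>"
    unfolding unbounded_orbits_def carrier_hilbert_image
  proof (intro ballI notI)
    fix z assume z: "z \<in> range T" and "M.mbounded (Group_Action.orbit \<Gamma> \<alpha> z)"
    then obtain c R where c: "Group_Action.orbit \<Gamma> \<alpha> z \<subseteq> M.mcball c R"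
      by (auto simp: M.mbounded_def)
    obtain x where x: "z = T x" using z by auto
    have near: "dist (preimage T c) (A \<gamma> x) \<le> R" if "\<gamma> \<in> carrier \<Gamma>" for \<gamma>
    proof -
      have "\<alpha> \<gamma> z \<in> Group_Action.orbit \<Gamma> \<alpha> z" using that by (auto simp: orbit_def)
      then have "\<alpha> \<gamma> z \<in> M.mcball c R" using c by blast
      then show ?thesis
        using T by (simp add: x \<alpha>T M.mcball_def hdist_hilbert_image[OF T])
    qed
    obtain \<gamma> where "\<gamma> \<in> S" "dist (A \<gamma> x) x > 2 * R" using far by blast
    moreover have "dist (A \<gamma> x) x \<le> dist (preimage T c) (A \<gamma> x) + dist (preimage T c) x"
      by (rule dist_triangle3)
    ultimately show False
      using near[of \<gamma>] near[OF \<Gamma>.one_closed] S one[of x] by auto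
  qed
  have "\<not> (\<exists>x\<in>carrier ?V. \<forall>\<gamma>\<in>S. \<alpha> \<gamma> x = x)"
  proof
    assume "\<exists>x\<in>carrier ?V. \<forall>\<gamma>\<in>S. \<alpha> \<gamma> x = x"
    then obtain x where x: "\<And>\<gamma>. \<gamma> \<in> S \<Longrightarrow> \<alpha> \<gamma> (T x) = T x"
      by (auto simp: carrier_hilbert_image)
    obtain \<gamma> where "\<gamma> \<in> S" "dist (A \<gamma> x) x > 0" using far by blast
    then show False using x[of \<gamma>] T by (simp add: \<alpha>T inj_eq)
  qed
  then show ?thesis
    using hilbert_space_hilbert_image[OF T] act unb by blast
qed


section \<open>Flip operators\<close>

definition toggle :: "'x \<Rightarrow> 'x fset \<Rightarrow> 'x fset" where
  "toggle x S = (if x |\<in>| S then S |-| {|x|} else finsert x S)"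

lemma mem_toggle: "y |\<in>| toggle x S \<longleftrightarrow> (y |\<in>| S) \<noteq> (y = x)"
  by (auto simp: toggle_def)

lemma toggle_toggle: "toggle x (toggle x S) = S"
  by (rule fset_eqI) (auto simp: mem_toggle)

lemma toggle_commute: "toggle x (toggle y S) = toggle y (toggle x S)"
  by (rule fset_eqI) (auto simp: mem_toggle)

text \<open>Let \<open>\<epsilon>\<^sub>x = \<plusminus>1\<close> be independent random signs of mean \<open>q\<close>, one for each point \<open>x\<close>. The products over
  \<open>x \<in> S\<close> of the normalized centred signs \<open>(\<epsilon>\<^sub>x - q) / sqrt (1 - q\<^sup>2)\<close>, for finite \<open>S\<close>, form an
  orthonormal basis of the square-integrable functions of the signs, and \<open>flip q x\<close> is the
  multiplication by \<open>\<epsilon>\<^sub>x\<close> in this basis. That is why flips are commuting isometric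
  involutions; \<open>vacuum\<close> is the constant function \<open>1\<close>.\<close>

definition flip :: "real \<Rightarrow> 'x \<Rightarrow> ('x fset \<Rightarrow> real) \<Rightarrow> 'x fset \<Rightarrow> real" where
  "flip q x v S = (if x |\<in>| S then - q else q) * v S + sqrt (1 - q\<^sup>2) * v (toggle x S)"

definition flips :: "real \<Rightarrow> 'x set \<Rightarrow> ('x fset \<Rightarrow> real) \<Rightarrow> 'x fset \<Rightarrow> real" where
  "flips q D v = Finite_Set.fold (flip q) v D"

definition vacuum :: "'x fset \<Rightarrow> real" where
  "vacuum S = (if S = {||} then 1 else 0)"

lemma flip_flip:
  assumes "\<bar>q\<bar> \<le> 1"
  shows "flip q x (flip q x v) = v"
proof
  fix S
  define s where "s = sqrt (1 - q\<^sup>2)"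
  have "0 \<le> 1 - q * q"
    using assms abs_square_le_1[of q] by (simp add: power2_eq_square)
  then have "s * s = 1 - q * q"
    by (simp add: s_def power2_eq_square)
  then have s: "s * (s * c) = c - q * (q * c)" for c
    by (simp add: mult.assoc[symmetric] left_diff_distrib)
  show "flip q x (flip q x v) S = v S"
    unfolding flip_def toggle_toggle mem_toggle s_def[symmetric]
    by (simp add: algebra_simps s)
qed

lemma flip_commute: "flip q x (flip q y v) = flip q y (flip q x v)"
proof
  fix S show "flip q x (flip q y v) S = flip q y (flip q x v) S"
    unfolding flip_def mem_toggle toggle_commute[of x y]
    by (cases "x = y") (auto simp: algebra_simps)
qed

lemma flip_linear:
  "flip q x (\<lambda>S. a * v S + b * w S) = (\<lambda>S. a * flip q x v S + b * flip q x w S)"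
  by (auto simp: flip_def fun_eq_iff algebra_simps)

text \<open>The mixed terms of the squares are odd under \<open>toggle x\<close> and cancel in the sum.\<close>

lemma flip_has_sum_square:
  assumes q: "\<bar>q\<bar> \<le> 1" and v: "((\<lambda>S. (v S)\<^sup>2) has_sum s) UNIV"
  shows "((\<lambda>S. (flip q x v S)\<^sup>2) has_sum s) UNIV"
proof -
  have reindex: "((\<lambda>S. f (toggle x S)) has_sum c) UNIV \<longleftrightarrow> (f has_sum c) UNIV"
    for f :: "'a fset \<Rightarrow> real" and c
    by (rule has_sum_reindex_bij_witness[where i = "toggle x" and j = "toggle x"])
      (auto simp: toggle_toggle)
  have v': "((\<lambda>S. (v (toggle x S))\<^sup>2) has_sum s) UNIV"
    using reindex[of "\<lambda>S. (v S)\<^sup>2"] v by simp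
  define m where "m S = (if x |\<in>| S then - 1 else 1) * v S * v (toggle x S)" for S
  have "(\<lambda>S. v S * v (toggle x S)) summable_on UNIV"
    using v v' by (intro square_summable_times) (auto dest: has_sum_imp_summable)
  then have "m summable_on UNIV"
    unfolding summable_on_iff_abs_summable_on_real[of m]
      summable_on_iff_abs_summable_on_real[of "\<lambda>S. v S * v (toggle x S)"]
    by (rule summable_on_cong[THEN iffD1, rotated]) (auto simp: m_def abs_mult)
  then obtain c where c: "(m has_sum c) UNIV"
    by (auto simp: summable_on_def)
  have "m (toggle x S) = - m S" for S
    by (simp add: m_def toggle_toggle mem_toggle)
  then have "((\<lambda>S. - m S) has_sum c) UNIV"
    using reindex[of m c] c by simp
  then have "(m has_sum - c) UNIV"
    by (simp add: has_sum_uminus)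
  then have "c = - c"
    using c has_sum_unique by blast
  then have m0: "(m has_sum 0) UNIV" using c by simp
  have "(flip q x v S)\<^sup>2
      = q\<^sup>2 * (v S)\<^sup>2 + ((1 - q\<^sup>2) * (v (toggle x S))\<^sup>2 + 2 * q * sqrt (1 - q\<^sup>2) * m S)" for S
    using q by (simp add: flip_def m_def power2_sum power_mult_distrib abs_square_le_1)
  moreover have "((\<lambda>S. q\<^sup>2 * (v S)\<^sup>2 + ((1 - q\<^sup>2) * (v (toggle x S))\<^sup>2 + 2 * q * sqrt (1 - q\<^sup>2) * m S))
      has_sum (q\<^sup>2 * s + ((1 - q\<^sup>2) * s + 2 * q * sqrt (1 - q\<^sup>2) * 0))) UNIV"
    by (intro has_sum_add has_sum_cmult_right v v' m0)
  moreover have "q\<^sup>2 * s + ((1 - q\<^sup>2) * s + 2 * q * sqrt (1 - q\<^sup>2) * 0) = s"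
    by (simp add: algebra_simps)
  ultimately show ?thesis by (simp only:)
qed

interpretation flip: comp_fun_commute "flip q" for q
  by standard (simp add: fun_eq_iff flip_commute o_def)

lemma flips_empty [simp]: "flips q {} v = v"
  by (simp add: flips_def)

lemma flips_insert:
  assumes "finite D" "x \<notin> D"
  shows "flips q (insert x D) v = flip q x (flips q D v)"
  unfolding flips_def using assms by (rule flip.fold_insert)

lemma flip_flips:
  assumes "\<bar>q\<bar> \<le> 1" "finite D"
  shows "flip q x (flips q D v) = flips q (sym_diff {x} D) v"
proof (cases "x \<in> D")
  case True
  then have "flips q D v = flip q x (flips q (D - {x}) v)"
    using flips_insert[of "D - {x}" x q v] assms by (simp add: insert_absorb)
  moreover have "sym_diff {x} D = D - {x}" using True by auto
  ultimately show ?thesis using assms by (simp add: flip_flip)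
next
  case False
  then have "sym_diff {x} D = insert x D" by auto
  then show ?thesis using flips_insert[OF assms(2) False] by simp
qed

lemma flips_flips:
  assumes q: "\<bar>q\<bar> \<le> 1" and D: "finite D" and E: "finite E"
  shows "flips q D (flips q E v) = flips q (sym_diff D E) v"
  using D
proof (induction D)
  case (insert x D)
  have "flips q (insert x D) (flips q E v) = flip q x (flips q (sym_diff D E) v)"
    using insert by (simp add: flips_insert)
  also have "\<dots> = flips q (sym_diff {x} (sym_diff D E)) v"
    using insert.hyps E by (intro flip_flips[OF q]) auto
  also have "sym_diff {x} (sym_diff D E) = sym_diff (insert x D) E"
    using insert.hyps by blast
  finally show ?case .
qed simp

lemma flips_linear:
  assumes "finite D"
  shows "flips q D (\<lambda>S. a * v S + b * w S) = (\<lambda>S. a * flips q D v S + b * flips q D w S)"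
  using assms by (induction D) (simp_all add: flips_insert flip_linear)

lemma flips_has_sum_square:
  assumes "\<bar>q\<bar> \<le> 1" "finite D" "((\<lambda>S. (v S)\<^sup>2) has_sum s) UNIV"
  shows "((\<lambda>S. (flips q D v S)\<^sup>2) has_sum s) UNIV"
  using assms(2) by (induction D) (use assms in \<open>auto simp: flips_insert intro: flip_has_sum_square\<close>)

lemma flips_vacuum_eq_0:
  assumes "finite D" "\<not> fset S \<subseteq> D"
  shows "flips q D vacuum S = 0"
  using assms
proof (induction D arbitrary: S)
  case empty
  then show ?case by (auto simp: vacuum_def)
next
  case (insert x D)
  have "\<not> fset S \<subseteq> D" "\<not> fset (toggle x S) \<subseteq> D"
    using insert.prems by (auto simp: toggle_def split: if_splits)
  then show ?case
    using insert by (simp add: flips_insert flip_def)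
qed

text \<open>The mean of a product of independent signs. In the induction the coefficient of \<open>{|x|}\<close> does not
  contribute, as \<open>flips q D vacuum\<close> lives on the subsets of \<open>D\<close>.\<close>

lemma flips_vacuum:
  assumes "finite D"
  shows "flips q D vacuum {||} = q ^ card D"
  using assms
proof (induction D)
  case (insert x D)
  have "flips q D vacuum {|x|} = 0"
    using insert by (intro flips_vacuum_eq_0) auto
  then show ?case
    using insert by (simp add: flips_insert flip_def toggle_def)
qed (simp add: vacuum_def)

lemma has_sum_vacuum_times: "((\<lambda>S. vacuum S * v S) has_sum v {||}) UNIV"
  by (rule has_sum_finite_neutralI[where B = "{{||}}"]) (auto simp: vacuum_def)


section \<open>The unitary representation of a commensurating action\<close>

locale commensurating_action = group G for G (structure) +
  fixes \<sigma> :: "'a \<Rightarrow> 'x \<Rightarrow> 'x" and X :: "'x set"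
  assumes act_mult: "\<lbrakk>g \<in> carrier G; h \<in> carrier G\<rbrakk> \<Longrightarrow> \<sigma> (g \<otimes> h) x = \<sigma> g (\<sigma> h x)"
    and act_one: "\<sigma> \<one> x = x"
    and finite_sym_diff: "g \<in> carrier G \<Longrightarrow> finite (sym_diff X (\<sigma> g ` X))"
begin

definition wall :: "'a \<Rightarrow> 'x set" where
  "wall g = sym_diff X (\<sigma> g ` X)"

lemma finite_wall: "g \<in> carrier G \<Longrightarrow> finite (wall g)"
  unfolding wall_def by (rule finite_sym_diff)

lemma act_inv:
  assumes "g \<in> carrier G"
  shows "\<sigma> (inv g) (\<sigma> g x) = x" "\<sigma> g (\<sigma> (inv g) x) = x"
  using assms by (simp_all add: act_mult[symmetric] act_one)

lemma inj_act: "g \<in> carrier G \<Longrightarrow> inj (\<sigma> g)"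
  by (metis injI act_inv(1))

lemma wall_mult:
  assumes g: "g \<in> carrier G" and h: "h \<in> carrier G"
  shows "wall (g \<otimes> h) = sym_diff (wall g) (\<sigma> g ` wall h)"
proof -
  have "\<sigma> (g \<otimes> h) ` X = \<sigma> g ` \<sigma> h ` X"
    using assms by (simp add: act_mult image_image)
  then show ?thesis
    unfolding wall_def image_Un image_set_diff[OF inj_act[OF g]] by blast
qed

lemma wall_one: "wall \<one> = {}"
  by (simp add: wall_def act_one)

definition len :: "'a \<Rightarrow> nat" where
  "len g = card (wall g)"

lemma len_mult_le:
  assumes "g \<in> carrier G" "h \<in> carrier G"
  shows "len (g \<otimes> h) \<le> len g + len h"
proof -
  have "len (g \<otimes> h) \<le> card (wall g \<union> \<sigma> g ` wall h)"
    unfolding len_def wall_mult[OF assms] using assms by (intro card_mono) (auto simp: finite_wall)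
  also have "\<dots> \<le> card (wall g) + card (\<sigma> g ` wall h)" by (rule card_Un_le)
  finally show ?thesis
    using assms by (simp add: len_def card_image inj_on_subset[OF inj_act])
qed

lemma len_inv:
  assumes "g \<in> carrier G"
  shows "len (inv g) = len g"
proof -
  have "sym_diff (wall g) (\<sigma> g ` wall (inv g)) = {}"
    using wall_mult[of g "inv g"] assms by (simp add: wall_one)
  then have "wall g = \<sigma> g ` wall (inv g)" by blast
  then show ?thesis
    using assms by (simp add: len_def card_image inj_on_subset[OF inj_act])
qed

definition permute :: "'a \<Rightarrow> ('x fset \<Rightarrow> real) \<Rightarrow> 'x fset \<Rightarrow> real" where
  "permute g v S = v (\<sigma> (inv g) |`| S)"

text \<open>Formally this is the permutation of the signs, conjugated by the multiplication with the product of
  all signs in \<open>X\<close>. That product need not be finite, but its quotient by its translate is the finite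
  product over the points of \<open>wall g\<close>.\<close>

definition fock :: "real \<Rightarrow> 'a \<Rightarrow> ('x fset \<Rightarrow> real) \<Rightarrow> 'x fset \<Rightarrow> real" where
  "fock q g v = flips q (wall g) (permute g v)"

lemma permute_flip:
  assumes g: "g \<in> carrier G"
  shows "permute g (flip q x v) = flip q (\<sigma> g x) (permute g v)"
proof
  fix S
  have mem: "y |\<in>| \<sigma> (inv g) |`| S \<longleftrightarrow> \<sigma> g y |\<in>| S" for y S
    using act_inv[OF g] by (auto simp: fimage_iff) (metis image_eqI)
  have "toggle x (\<sigma> (inv g) |`| S) = \<sigma> (inv g) |`| toggle (\<sigma> g x) S"
    by (rule fset_eqI) (simp only: mem_toggle mem inj_eq[OF inj_act[OF g]])
  then show "permute g (flip q x v) S = flip q (\<sigma> g x) (permute g v) S"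
    by (simp only: permute_def flip_def mem)
qed

lemma permute_flips:
  assumes g: "g \<in> carrier G" and D: "finite D"
  shows "permute g (flips q D v) = flips q (\<sigma> g ` D) (permute g v)"
  using D
proof (induction D)
  case (insert x D)
  then have "\<sigma> g x \<notin> \<sigma> g ` D" using inj_act[OF g] by (simp add: inj_image_mem_iff)
  then show ?case using insert by (simp add: flips_insert permute_flip[OF g])
qed simp

lemma permute_mult:
  assumes "g \<in> carrier G" "h \<in> carrier G"
  shows "permute (g \<otimes> h) v = permute g (permute h v)"
proof -
  have "\<sigma> (inv (g \<otimes> h)) = \<sigma> (inv h) \<circ> \<sigma> (inv g)"
    using assms by (simp add: fun_eq_iff inv_mult_group act_mult)
  then show ?thesis by (intro ext) (simp add: permute_def fset.map_comp)
qed

lemma permute_has_sum_square: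
  assumes g: "g \<in> carrier G" and v: "((\<lambda>S. (v S)\<^sup>2) has_sum s) UNIV"
  shows "((\<lambda>S. (permute g v S)\<^sup>2) has_sum s) UNIV"
proof -
  have "((\<lambda>S. (permute g v S)\<^sup>2) has_sum s) UNIV \<longleftrightarrow> ((\<lambda>S. (v S)\<^sup>2) has_sum s) UNIV"
    by (rule has_sum_reindex_bij_witness[where i = "(|`|) (\<sigma> g)" and j = "(|`|) (\<sigma> (inv g))"])
      (simp_all add: permute_def fset.map_comp o_def act_inv[OF g] fset.map_ident)
  then show ?thesis using v by simp
qed

lemma fock_one: "fock q \<one> v = v"
proof -
  have "\<sigma> \<one> = id" by (simp add: fun_eq_iff act_one)
  then show ?thesis by (intro ext) (simp add: fock_def wall_one permute_def)
qed

text \<open>The cocycle identity \<open>wall_mult\<close> is what makes \<open>fock q\<close> multiplicative: products of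
  flips multiply like symmetric differences.\<close>

lemma fock_mult:
  assumes q: "\<bar>q\<bar> \<le> 1" and g: "g \<in> carrier G" and h: "h \<in> carrier G"
  shows "fock q (g \<otimes> h) v = fock q g (fock q h v)"
  using g h finite_wall[OF g] finite_wall[OF h] q
  by (simp add: fock_def permute_flips flips_flips permute_mult wall_mult)

lemma fock_linear:
  assumes "g \<in> carrier G"
  shows "fock q g (\<lambda>S. a * v S + b * w S) = (\<lambda>S. a * fock q g v S + b * fock q g w S)"
  using flips_linear[OF finite_wall[OF assms], of q a "permute g v" b "permute g w"]
  by (simp add: fock_def permute_def[abs_def])

lemma fock_has_sum_square:
  assumes "\<bar>q\<bar> \<le> 1" "g \<in> carrier G" "((\<lambda>S. (v S)\<^sup>2) has_sum s) UNIV"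
  shows "((\<lambda>S. (fock q g v S)\<^sup>2) has_sum s) UNIV"
  unfolding fock_def
  using assms by (intro flips_has_sum_square permute_has_sum_square finite_wall)

lemma fock_vacuum:
  assumes "g \<in> carrier G"
  shows "fock q g vacuum {||} = q ^ len g"
proof -
  have "permute g vacuum = vacuum"
    by (auto simp: permute_def vacuum_def fun_eq_iff)
  then show ?thesis
    using assms by (simp add: fock_def len_def flips_vacuum finite_wall)
qed

text \<open>The rate at which \<open>fock q g\<close> moves the vacuum: hardly at all when \<open>q\<close> is close to \<open>1\<close> and
  \<open>len g\<close> is bounded, but by about \<open>2\<close> when \<open>len g\<close> is large compared with \<open>1 / (1 - q)\<close>.\<close>

lemma fock_vacuum_displacement:
  assumes q: "\<bar>q\<bar> \<le> 1" and g: "g \<in> carrier G"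
  shows "((\<lambda>S. (fock q g vacuum S - vacuum S)\<^sup>2) has_sum (2 - 2 * q ^ len g)) UNIV"
proof -
  have vac: "((\<lambda>S. (vacuum S)\<^sup>2) has_sum 1) UNIV"
    using has_sum_vacuum_times[of vacuum] by (simp add: power2_eq_square vacuum_def)
  have "(fock q g vacuum S - vacuum S)\<^sup>2
      = (fock q g vacuum S)\<^sup>2 + ((vacuum S)\<^sup>2 + - 2 * (vacuum S * fock q g vacuum S))" for S
    by (simp add: power2_eq_square algebra_simps)
  moreover have "((\<lambda>S. (fock q g vacuum S)\<^sup>2 + ((vacuum S)\<^sup>2 + - 2 * (vacuum S * fock q g vacuum S)))
      has_sum (1 + (1 + - 2 * q ^ len g))) UNIV"
    by (intro has_sum_add has_sum_cmult_right vac fock_has_sum_square[OF q g vac]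
        has_sum_vacuum_times[of "fock q g vacuum", unfolded fock_vacuum[OF g]])
  ultimately show ?thesis by simp
qed

end


section \<open>Elements that are long for finitely many length functions\<close>

text \<open>If \<open>g\<close> is long for the lengths in \<open>J\<close> but short for one more length, multiply it by an element \<open>h\<close>
  that is long for the additional length. Taking \<open>g\<close> much longer than \<open>h\<close> for the lengths in \<open>J\<close>
  ensures that the triangle inequality keeps the product long for them.\<close>

lemma (in group) simultaneously_long:
  fixes l :: "'j \<Rightarrow> 'a \<Rightarrow> nat"
  assumes "finite J"
    and mult: "\<And>j g h. \<lbrakk>j \<in> J; g \<in> carrier G; h \<in> carrier G\<rbrakk> \<Longrightarrow> l j (g \<otimes> h) \<le> l j g + l j h"
    and inverse: "\<And>j g. \<lbrakk>j \<in> J; g \<in> carrier G\<rbrakk> \<Longrightarrow> l j (inv g) = l j g"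
    and unbounded: "\<And>j R. j \<in> J \<Longrightarrow> \<exists>g\<in>carrier G. l j g > R"
  shows "\<exists>g\<in>carrier G. \<forall>j\<in>J. l j g > R"
  using assms
proof (induction J arbitrary: R)
  case (insert i J)
  obtain h where h: "h \<in> carrier G" "l i h > 2 * R"
    using insert.prems(3)[of i "2 * R"] by auto
  have "\<exists>g\<in>carrier G. \<forall>j\<in>J. l j g > R + (\<Sum>j\<in>J. l j h)"
    using insert.prems by (intro insert.IH) auto
  then obtain g where g: "g \<in> carrier G" "\<And>j. j \<in> J \<Longrightarrow> l j g > R + (\<Sum>j\<in>J. l j h)" by blast
  have far: "l j g > R + l j h" if "j \<in> J" for j
    using g(2)[OF that] member_le_sum[OF that, of "\<lambda>j. l j h"] insert.hyps by simp
  show ?case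
  proof (cases "l i g > R")
    case True
    then show ?thesis using far g(1) by (intro bexI[of _ g]) force+
  next
    case False
    have "l i h \<le> l i (h \<otimes> g) + l i g"
      using insert.prems(1)[of i "h \<otimes> g" "inv g"] insert.prems(2)[of i g] g(1) h(1)
      by (simp add: m_assoc)
    moreover have "l j g \<le> l j h + l j (h \<otimes> g)" if "j \<in> J" for j
      using insert.prems(1)[of j "inv h" "h \<otimes> g"] insert.prems(2)[of j h] g(1) h(1) that
      by (simp add: m_assoc[symmetric])
    ultimately show ?thesis
      using False far h g(1) by (intro bexI[of _ "h \<otimes> g"]) force+
  qed
qed auto


section \<open>Square sums over fibres\<close>

lemma fibrewise_has_sum_square:
  fixes v w :: "'k \<times> 'l \<Rightarrow> real"
  assumes v: "((\<lambda>i. (v i)\<^sup>2) has_sum s) UNIV"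
    and vw: "\<And>a c. ((\<lambda>b. (v (a, b))\<^sup>2) has_sum c) UNIV \<Longrightarrow> ((\<lambda>b. (w (a, b))\<^sup>2) has_sum c) UNIV"
  shows "((\<lambda>i. (w i)\<^sup>2) has_sum s) UNIV"
proof -
  define c where "c a = (\<Sum>\<^sub>\<infinity>b. (v (a, b))\<^sup>2)" for a
  have "(\<lambda>(a, b). (v (a, b))\<^sup>2) summable_on Sigma UNIV (\<lambda>_. UNIV)"
    using has_sum_imp_summable[OF v] by (simp add: case_prod_beta')
  then have "(\<lambda>b. (v (a, b))\<^sup>2) summable_on UNIV" for a
    using summable_on_SigmaD1[of "\<lambda>a b. (v (a, b))\<^sup>2" UNIV "\<lambda>_. UNIV" a] by simp
  then have fv: "((\<lambda>b. (v (a, b))\<^sup>2) has_sum c a) UNIV" for a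
    by (simp add: c_def)
  then have fw: "((\<lambda>b. (w (a, b))\<^sup>2) has_sum c a) UNIV" for a
    by (rule vw)
  have c: "(c has_sum s) UNIV"
    by (rule has_sum_SigmaD[where f = "\<lambda>i. (v i)\<^sup>2" and B = "\<lambda>_. UNIV"]) (use v fv in auto)
  have "(\<lambda>i. (w i)\<^sup>2) summable_on Sigma UNIV (\<lambda>_. UNIV)"
    by (rule summable_on_SigmaI[where g = c]) (use fw c has_sum_imp_summable in auto)
  then have "((\<lambda>i. (w i)\<^sup>2) has_sum s) (Sigma UNIV (\<lambda>_. UNIV))"
    by (intro has_sum_SigmaI[where g = c]) (use fw c in auto)
  then show ?thesis by simp
qed

lemma square_summable_if_geometric:
  fixes w :: "(nat \<times> 'j) \<times> 'l \<Rightarrow> real"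
  assumes fibre: "\<And>N j. ((\<lambda>b. (w ((N, j), b))\<^sup>2) has_sum c N j) UNIV"
    and fin: "\<And>N. finite (J N)" and zero: "\<And>N j. j \<notin> J N \<Longrightarrow> c N j = 0"
    and bound: "\<And>N. N \<ge> M \<Longrightarrow> (\<Sum>j\<in>J N. c N j) \<le> C * (1/4) ^ N"
  shows "square_summable w"
proof -
  have nonneg: "0 \<le> c N j" for N j
    using fibre[of N j] by (rule has_sum_nonneg) simp
  have "summable (\<lambda>N. \<Sum>j\<in>J N. c N j)"
  proof (rule summable_comparison_test')
    show "summable (\<lambda>N. C * (1/4 :: real) ^ N)"
      by (intro summable_mult summable_geometric) simp
    show "norm (\<Sum>j\<in>J N. c N j) \<le> C * (1/4) ^ N" if "N \<ge> M" for N
      using bound[OF that] nonneg by (simp add: sum_nonneg)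
  qed
  then have "(\<lambda>N. \<Sum>j\<in>J N. c N j) summable_on UNIV"
    by (intro summable_nonneg_imp_summable_on) (simp_all add: sum_nonneg nonneg)
  moreover have "(c N has_sum (\<Sum>j\<in>J N. c N j)) UNIV" for N
    by (rule has_sum_finite_neutralI[where B = "J N"]) (use fin zero in auto)
  ultimately have "(\<lambda>(N, j). c N j) summable_on Sigma UNIV (\<lambda>_. UNIV)"
    by (intro summable_on_SigmaI[where g = "\<lambda>N. \<Sum>j\<in>J N. c N j"]) (use nonneg in auto)
  then have "(\<lambda>i. (w i)\<^sup>2) summable_on Sigma UNIV (\<lambda>_. UNIV)"
    by (intro summable_on_SigmaI[where g = "\<lambda>(N, j). c N j"]) (use fibre in auto)
  then show ?thesis by simp
qed


section \<open>The action of the mapping torus\<close>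

lemma square_half_power: "((1/2 :: real) ^ N)\<^sup>2 = (1/4) ^ N"
proof -
  have "((1/2 :: real) ^ N)\<^sup>2 = ((1/2)\<^sup>2) ^ N"
    by (simp only: power_mult[symmetric] mult.commute)
  then show ?thesis by (simp add: power2_eq_square)
qed

locale torus_of_commensurating_action = commensurating_action G \<sigma> X
  for G :: "('a, 'b) monoid_scheme" (structure) and \<sigma> :: "'a \<Rightarrow> nat \<Rightarrow> nat" and X +
  fixes \<phi> :: "'a \<Rightarrow> 'a"
  assumes auto: "\<phi> \<in> auto G"
    and countable: "countable (carrier G)"
    and unbounded_len: "\<exists>g\<in>carrier G. len g > R"
begin

abbreviation twist :: "int \<Rightarrow> 'a \<Rightarrow> 'a" where
  "twist j \<equiv> \<phi> [^]\<^bsub>AutoGroup G\<^esub> j"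

lemma twist_hom: "twist j \<in> hom G G"
  using auto_int_pow_in_auto[OF is_group auto, of j] by (simp add: auto_def)

lemma twist_closed: "g \<in> carrier G \<Longrightarrow> twist j g \<in> carrier G"
  using twist_hom[of j] by (rule hom_in_carrier)

lemma twist_mult:
  "\<lbrakk>g \<in> carrier G; h \<in> carrier G\<rbrakk> \<Longrightarrow> twist j (g \<otimes> h) = twist j g \<otimes> twist j h"
  using twist_hom[of j] by (rule hom_mult)

lemma twist_one: "twist j \<one> = \<one>"
  using twist_hom[of j] is_group is_group by (rule hom_one)

lemma twist_inv: "g \<in> carrier G \<Longrightarrow> twist j (inv g) = inv (twist j g)"
  by (metis twist_closed twist_mult twist_one inv_closed inv_equality l_inv)

lemma twist_add: "g \<in> carrier G \<Longrightarrow> twist (i + j) g = twist i (twist j g)"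
  by (rule auto_int_pow_apply_add[OF is_group auto])

lemma one_AutoGroup: "g \<in> carrier G \<Longrightarrow> \<one>\<^bsub>AutoGroup G\<^esub> g = g"
  by (simp add: AutoGroup_def BijGroup_def)

text \<open>In the \<open>N\<close>-th summand the parameter \<open>decay N\<close> is so close to \<open>1\<close> that every \<open>g\<close> among the elements
  with number at most \<open>N\<close> satisfies a uniform bound: the square distances by which its twists by the
  \<open>8\<^sup>N\<close> powers of the automorphism occurring there move the vacuum add up to at most \<open>2\<close>.\<close>

definition cost :: "nat \<Rightarrow> nat" where
  "cost N = (\<Sum>j\<in>{0..<8 ^ N}. \<Sum>i\<le>N. len (twist j (from_nat_into (carrier G) i)))"

definition decay :: "nat \<Rightarrow> real" where
  "decay N = 1 - 1 / (2 + cost N)"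

lemma decay_pos: "0 < decay N" and decay_less_1: "decay N < 1"
  by (simp_all add: decay_def field_simps)

lemma abs_decay: "\<bar>decay N\<bar> \<le> 1"
  using decay_pos[of N] decay_less_1[of N] by simp

text \<open>For each \<open>N\<close> this is the representation induced from the representation \<open>fock (decay N)\<close> of the
  group: there is one copy for each power \<open>j\<close> of the stable letter, the group acts on it
  through \<open>twist j\<close>, and the stable letter shifts the copies.\<close>

definition torus_rep :: "'a \<times> int \<Rightarrow> ((nat \<times> int) \<times> nat fset \<Rightarrow> real) \<Rightarrow> (nat \<times> int) \<times> nat fset \<Rightarrow> real" where
  "torus_rep = (\<lambda>(g, m) v ((N, j), S). fock (decay N) (twist j g) (\<lambda>S. v ((N, j - m), S)) S)"

definition window :: "(nat \<times> int) \<times> nat fset \<Rightarrow> real" where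
  "window = (\<lambda>((N, j), S). if 0 \<le> j \<and> j < 8 ^ N then (1/2) ^ N * vacuum S else 0)"

lemma carrier_torus: "carrier (mapping_torus G \<phi>) = carrier G \<times> UNIV"
  by (simp add: mapping_torus_def)

lemma torus_rep_mult:
  assumes "\<gamma> \<in> carrier (mapping_torus G \<phi>)" "\<delta> \<in> carrier (mapping_torus G \<phi>)"
  shows "torus_rep (\<gamma> \<otimes>\<^bsub>mapping_torus G \<phi>\<^esub> \<delta>) v = torus_rep \<gamma> (torus_rep \<delta> v)"
proof -
  obtain g m h n where \<gamma>\<delta>: "\<gamma> = (g, m)" "\<delta> = (h, n)" and gh: "g \<in> carrier G" "h \<in> carrier G"
    using assms by (auto simp: carrier_torus)
  have tw: "twist j (g \<otimes> twist (- m) h) = twist j g \<otimes> twist (j - m) h" for j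
    using twist_add[of h j "- m"] gh by (simp add: twist_mult twist_closed)
  show ?thesis
    using gh by (simp add: torus_rep_def \<gamma>\<delta> fun_eq_iff mapping_torus_def tw fock_mult abs_decay twist_closed
        diff_diff_eq)
qed

lemma torus_rep_one: "torus_rep \<one>\<^bsub>mapping_torus G \<phi>\<^esub> v = v"
  by (simp add: torus_rep_def mapping_torus_def fun_eq_iff twist_one fock_one)

lemma torus_rep_linear:
  assumes "\<gamma> \<in> carrier (mapping_torus G \<phi>)"
  shows "torus_rep \<gamma> (\<lambda>i. a * v i + b * w i) = (\<lambda>i. a * torus_rep \<gamma> v i + b * torus_rep \<gamma> w i)"
  using assms
  by (auto simp: torus_rep_def carrier_torus fun_eq_iff fock_linear twist_closed)

lemma torus_rep_add:
  assumes "\<gamma> \<in> carrier (mapping_torus G \<phi>)"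
  shows "torus_rep \<gamma> (\<lambda>i. v i + w i) = (\<lambda>i. torus_rep \<gamma> v i + torus_rep \<gamma> w i)"
  using torus_rep_linear[OF assms, of 1 v 1 w] by simp

lemma torus_rep_diff:
  assumes "\<gamma> \<in> carrier (mapping_torus G \<phi>)"
  shows "torus_rep \<gamma> (\<lambda>i. v i - w i) = (\<lambda>i. torus_rep \<gamma> v i - torus_rep \<gamma> w i)"
  using torus_rep_linear[OF assms, of 1 v "- 1" w] by simp

lemma torus_rep_has_sum_square:
  assumes \<gamma>: "\<gamma> \<in> carrier (mapping_torus G \<phi>)" and v: "((\<lambda>i. (v i)\<^sup>2) has_sum s) UNIV"
  shows "((\<lambda>i. (torus_rep \<gamma> v i)\<^sup>2) has_sum s) UNIV"
proof -
  obtain g m where g: "\<gamma> = (g, m)" "g \<in> carrier G"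
    using \<gamma> by (auto simp: carrier_torus)
  define u where "u = (\<lambda>((N, j), S). v ((N, j - m), S))"
  have "((\<lambda>i. (u i)\<^sup>2) has_sum s) UNIV \<longleftrightarrow> ((\<lambda>i. (v i)\<^sup>2) has_sum s) UNIV"
    by (rule has_sum_reindex_bij_witness[where i = "\<lambda>((N, j), S). ((N, j + m), S)"
          and j = "\<lambda>((N, j), S). ((N, j - m), S)"]) (auto simp: u_def)
  then have u: "((\<lambda>i. (u i)\<^sup>2) has_sum s) UNIV" using v by simp
  show ?thesis
  proof (rule fibrewise_has_sum_square[OF u])
    fix a c assume a: "((\<lambda>b. (u (a, b))\<^sup>2) has_sum c) UNIV"
    obtain N j where "a = (N, j)" by (cases a)
    then show "((\<lambda>b. (torus_rep \<gamma> v (a, b))\<^sup>2) has_sum c) UNIV"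
      using fock_has_sum_square[OF abs_decay twist_closed[OF g(2)] a, of N j]
      by (simp add: torus_rep_def g u_def)
  qed
qed

text \<open>The function \<open>window\<close> is not square-summable: its \<open>N\<close>-th summand consists of \<open>8\<^sup>N\<close> vectors of square
  norm \<open>4\<^sup>-\<^sup>N\<close>. The action by affine isometries in question is the one of \<open>torus_rep\<close> on the
  affine space of the functions that differ from \<open>window\<close> by a square-summable one.\<close>

definition displacement :: "'a \<times> int \<Rightarrow> (nat \<times> int) \<times> nat fset \<Rightarrow> real" where
  "displacement \<gamma> i = torus_rep \<gamma> window i - window i"

lemma displacement_mult:
  assumes "\<gamma> \<in> carrier (mapping_torus G \<phi>)" "\<delta> \<in> carrier (mapping_torus G \<phi>)"
  shows "displacement (\<gamma> \<otimes>\<^bsub>mapping_torus G \<phi>\<^esub> \<delta>) i = torus_rep \<gamma> (displacement \<delta>) i + displacement \<gamma> i"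
  unfolding displacement_def[abs_def] torus_rep_mult[OF assms] torus_rep_diff[OF assms(1)] by simp

lemma displacement_fibre:
  assumes g: "g \<in> carrier G"
  shows "((\<lambda>S. (displacement (g, 0) ((N, j), S))\<^sup>2) has_sum
    (if 0 \<le> j \<and> j < 8 ^ N then (1/4) ^ N * (2 - 2 * decay N ^ len (twist j g)) else 0)) UNIV"
proof (cases "0 \<le> j \<and> j < 8 ^ N")
  case True
  let ?u = "\<lambda>S. fock (decay N) (twist j g) vacuum S - vacuum S"
  have "fock (decay N) (twist j g) (\<lambda>S. (1/2) ^ N * vacuum S)
      = (\<lambda>S. (1/2) ^ N * fock (decay N) (twist j g) vacuum S)"
    using fock_linear[OF twist_closed[OF g], of "decay N" j "(1/2) ^ N" vacuum 0 vacuum] by simp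
  then have "displacement (g, 0) ((N, j), S) = (1/2) ^ N * ?u S" for S
    using True by (simp add: displacement_def torus_rep_def window_def right_diff_distrib)
  then have "(displacement (g, 0) ((N, j), S))\<^sup>2 = (1/4) ^ N * (?u S)\<^sup>2" for S
    by (simp only: power_mult_distrib square_half_power)
  then show ?thesis
    using True has_sum_cmult_right[OF fock_vacuum_displacement[OF abs_decay twist_closed[OF g]]]
    by simp
next
  case False
  have "fock (decay N) (twist j g) (\<lambda>S. 0) = (\<lambda>S. 0)"
    using fock_linear[OF twist_closed[OF g], of "decay N" j 0 vacuum 0 vacuum] by simp
  then have "displacement (g, 0) ((N, j), S) = 0" for S
    using False by (auto simp: displacement_def torus_rep_def window_def)
  then show ?thesis unfolding if_not_P[OF False] by simp
qed

text \<open>Only finitely many summands precede the index of \<open>g\<close> in the enumeration of the group. In all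
  others the choice of \<open>decay\<close> leaves a square norm of at most \<open>2 \<cdot> 4\<^sup>-\<^sup>N\<close>.\<close>

lemma square_summable_displacement_group:
  assumes g: "g \<in> carrier G"
  shows "square_summable (displacement (g, 0))"
proof -
  obtain i where i: "from_nat_into (carrier G) i = g"
    using from_nat_into_surj[OF countable g] by blast
  show ?thesis
  proof (rule square_summable_if_geometric[OF displacement_fibre[OF g],
        where J = "\<lambda>N. {0..<8 ^ N}" and M = i])
    fix N assume N: "i \<le> N"
    have "2 - 2 * decay N ^ n \<le> 2 * (n / (2 + cost N))" for n
      using Bernoulli_inequality[of "- (1 / (2 + cost N))" n] by (simp add: decay_def field_simps)
    then have "(\<Sum>j\<in>{0..<8 ^ N}. 2 - 2 * decay N ^ len (twist j g))
        \<le> (\<Sum>j\<in>{0..<8 ^ N}. 2 * (len (twist j g) / (2 + cost N)))"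
      by (intro sum_mono)
    also have "\<dots> = 2 * ((\<Sum>j\<in>{0..<8 ^ N}. len (twist j g)) / (2 + cost N))"
      by (simp add: sum_distrib_left sum_divide_distrib)
    also have "\<dots> \<le> 2"
    proof -
      have "(\<Sum>j\<in>{0..<8 ^ N}. len (twist j g)) \<le> cost N"
        unfolding cost_def i[symmetric]
        by (intro sum_mono member_le_sum[of i _ "\<lambda>i. len (twist j (from_nat_into (carrier G) i))" for j])
          (use N in auto)
      then have "real (\<Sum>j\<in>{0..<8 ^ N}. len (twist j g)) \<le> real (cost N)"
        by (simp only: of_nat_le_iff)
      then show ?thesis by (simp add: field_simps)
    qed
    finally have "(\<Sum>j\<in>{0..<8 ^ N}. 2 - 2 * decay N ^ len (twist j g)) \<le> 2" .
    then have "(1/4) ^ N * (\<Sum>j\<in>{0..<8 ^ N}. 2 - 2 * decay N ^ len (twist j g)) \<le> 2 * (1/4) ^ N"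
      by simp
    then show "(\<Sum>j\<in>{0..<8 ^ N}. if 0 \<le> j \<and> j < 8 ^ N
        then (1/4) ^ N * (2 - 2 * decay N ^ len (twist j g)) else 0) \<le> 2 * (1/4) ^ N"
      by (simp add: sum_distrib_left)
  qed auto
qed

text \<open>A shift changes the window only near its two ends, hence in a number of copies that does not
  depend on \<open>N\<close>.\<close>

lemma square_summable_displacement_shift: "square_summable (displacement (\<one>, m))"
proof -
  define ind :: "nat \<Rightarrow> int \<Rightarrow> real" where "ind N j = (if 0 \<le> j \<and> j < 8 ^ N then 1 else 0)" for N j
  have "displacement (\<one>, m) ((N, j), S) = (1/2) ^ N * (ind N (j - m) - ind N j) * vacuum S"
    for N j S
    by (auto simp: displacement_def torus_rep_def window_def twist_one fock_one ind_def)
  then have "(displacement (\<one>, m) ((N, j), S))\<^sup>2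
      = (1/4) ^ N * (ind N (j - m) - ind N j)\<^sup>2 * (vacuum S * vacuum S)" for N j S
    by (simp only: power_mult_distrib square_half_power power2_eq_square[of "vacuum S"])
  moreover have "((\<lambda>S :: nat fset. (1/4) ^ N * (ind N (j - m) - ind N j)\<^sup>2 * (vacuum S * vacuum S))
      has_sum ((1/4) ^ N * (ind N (j - m) - ind N j)\<^sup>2 * vacuum ({||} :: nat fset))) UNIV" for N j
    by (intro has_sum_cmult_right has_sum_vacuum_times[where v = vacuum])
  ultimately have fibre: "((\<lambda>S. (displacement (\<one>, m) ((N, j), S))\<^sup>2) has_sum
      ((1/4) ^ N * (ind N (j - m) - ind N j)\<^sup>2)) UNIV" for N j
    by (simp add: vacuum_def)
  let ?J = "\<lambda>N::nat. {- \<bar>m\<bar> .. \<bar>m\<bar>} \<union> {8 ^ N - \<bar>m\<bar> .. 8 ^ N + \<bar>m\<bar>}"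
  show ?thesis
  proof (rule square_summable_if_geometric[OF fibre, where J = ?J])
    fix N
    have "card (?J N) \<le> 2 * nat (2 * \<bar>m\<bar> + 1)"
      by (rule order_trans[OF card_Un_le]) (simp add: algebra_simps)
    moreover have "(\<Sum>j\<in>?J N. (1/4) ^ N * (ind N (j - m) - ind N j)\<^sup>2) \<le> card (?J N) * (1/4) ^ N"
      by (rule sum_bounded_above) (auto simp: ind_def)
    ultimately show "(\<Sum>j\<in>?J N. (1/4) ^ N * (ind N (j - m) - ind N j)\<^sup>2)
        \<le> real (2 * nat (2 * \<bar>m\<bar> + 1)) * (1/4) ^ N"
      by (meson order_trans mult_right_mono of_nat_mono zero_le_power zero_le_divide_1_iff zero_le_numeral)
  next
    fix N j assume "j \<notin> ?J N"
    then have "ind N (j - m) = ind N j" by (auto simp: ind_def)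
    then show "(1/4) ^ N * (ind N (j - m) - ind N j)\<^sup>2 = 0" by simp
  qed auto
qed

lemma square_summable_displacement:
  assumes "\<gamma> \<in> carrier (mapping_torus G \<phi>)"
  shows "square_summable (displacement \<gamma>)"
proof -
  obtain g m where g: "\<gamma> = (g, m)" "g \<in> carrier G"
    using assms by (auto simp: carrier_torus)
  have mem: "(g, 0) \<in> carrier (mapping_torus G \<phi>)" "(\<one>, m) \<in> carrier (mapping_torus G \<phi>)"
    using g by (simp_all add: carrier_torus)
  have "\<gamma> = (g, 0) \<otimes>\<^bsub>mapping_torus G \<phi>\<^esub> (\<one>, m)"
    using g by (simp add: mapping_torus_def one_AutoGroup)
  moreover have "square_summable (torus_rep (g, 0) (displacement (\<one>, m)))"
    using torus_rep_has_sum_square[OF mem(1)] square_summable_displacement_shift[of m]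
    unfolding summable_on_def by blast
  ultimately show ?thesis
    using square_summable_add square_summable_displacement_group[OF g(2)]
    by (simp add: displacement_mult[OF mem])
qed

definition linear_part :: "'a \<times> int \<Rightarrow> ((nat \<times> int) \<times> nat fset) ell2 \<Rightarrow> ((nat \<times> int) \<times> nat fset) ell2" where
  "linear_part \<gamma> x = Ell2 (torus_rep \<gamma> (coord x))"

definition translation :: "'a \<times> int \<Rightarrow> ((nat \<times> int) \<times> nat fset) ell2" where
  "translation \<gamma> = Ell2 (displacement \<gamma>)"

lemma coord_translation: "\<gamma> \<in> carrier (mapping_torus G \<phi>) \<Longrightarrow> coord (translation \<gamma>) = displacement \<gamma>"
  unfolding translation_def by (intro coord_Ell2 square_summable_displacement)

lemma coord_linear_part: "\<gamma> \<in> carrier (mapping_torus G \<phi>) \<Longrightarrow> coord (linear_part \<gamma> x) = torus_rep \<gamma> (coord x)"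
  unfolding linear_part_def by (rule has_sum_norm_square_Ell2(1)[OF torus_rep_has_sum_square[OF _ has_sum_norm_square]])

lemma norm_linear_part:
  assumes "\<gamma> \<in> carrier (mapping_torus G \<phi>)"
  shows "norm (linear_part \<gamma> x) = norm x"
  using has_sum_norm_square_Ell2(2)[OF torus_rep_has_sum_square[OF assms has_sum_norm_square[of x]]]
  by (simp add: linear_part_def)

lemma linear_linear_part:
  assumes \<gamma>: "\<gamma> \<in> carrier (mapping_torus G \<phi>)"
  shows "linear (linear_part \<gamma>)"
proof (rule linearI)
  fix x y :: "((nat \<times> int) \<times> nat fset) ell2" and c :: real
  have "coord (x + y) = (\<lambda>i. coord x i + coord y i)" by (simp add: fun_eq_iff coord_add)
  then show "linear_part \<gamma> (x + y) = linear_part \<gamma> x + linear_part \<gamma> y"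
    by (intro ell2_eqI) (simp add: coord_linear_part[OF \<gamma>] coord_add torus_rep_add[OF \<gamma>])
  have "coord (c *\<^sub>R x) = (\<lambda>i. c * coord x i)"
    by (simp add: fun_eq_iff coord_scaleR)
  moreover have "torus_rep \<gamma> (\<lambda>i. c * coord x i) = (\<lambda>i. c * torus_rep \<gamma> (coord x) i)"
    using torus_rep_linear[OF \<gamma>, of c "coord x" 0 "coord x"] by simp
  ultimately show "linear_part \<gamma> (c *\<^sub>R x) = c *\<^sub>R linear_part \<gamma> x"
    by (intro ell2_eqI) (simp add: coord_linear_part[OF \<gamma>] coord_scaleR)
qed

lemma translation_mult:
  assumes "\<gamma> \<in> carrier (mapping_torus G \<phi>)" "\<delta> \<in> carrier (mapping_torus G \<phi>)"
  shows "translation (\<gamma> \<otimes>\<^bsub>mapping_torus G \<phi>\<^esub> \<delta>) = linear_part \<gamma> (translation \<delta>) + translation \<gamma>"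
  using assms group.is_monoid[OF group_mapping_torus[OF is_group auto]]
  by (intro ell2_eqI)
    (simp add: coord_add coord_linear_part coord_translation monoid.m_closed displacement_mult)

lemma linear_part_mult:
  assumes "\<gamma> \<in> carrier (mapping_torus G \<phi>)" "\<delta> \<in> carrier (mapping_torus G \<phi>)"
  shows "linear_part (\<gamma> \<otimes>\<^bsub>mapping_torus G \<phi>\<^esub> \<delta>) x = linear_part \<gamma> (linear_part \<delta> x)"
  using assms group.is_monoid[OF group_mapping_torus[OF is_group auto]]
  by (intro ell2_eqI) (simp add: coord_linear_part monoid.m_closed torus_rep_mult)

text \<open>An element that is long for all twists in the window moves each of the \<open>8\<^sup>N\<close> vectors of square norm
  \<open>4\<^sup>-\<^sup>N\<close> by a square distance of at least \<open>4\<^sup>-\<^sup>N\<close>, hence the whole by at least \<open>2\<^sup>N\<close>.\<close>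

lemma unbounded_translation: "\<exists>g\<in>carrier G. norm (translation (g, 0)) > R"
proof -
  obtain N where N: "R\<^sup>2 < 2 ^ N"
    using real_arch_pow[of 2 "R\<^sup>2"] by auto
  obtain K where K: "decay N ^ K < 1/2"
    using real_arch_pow_inv[of "1/2" "decay N"] decay_less_1 by auto
  have "\<exists>g\<in>carrier G. \<forall>j\<in>{0..<8 ^ N :: int}. len (twist j g) > K"
  proof (rule simultaneously_long)
    fix j :: int and R
    obtain g where "g \<in> carrier G" "len g > R" using unbounded_len by blast
    then show "\<exists>g\<in>carrier G. len (twist j g) > R"
      using twist_add[of g j "- j"]
      by (intro bexI[of _ "twist (- j) g"]) (simp_all add: twist_closed one_AutoGroup)
  qed (simp_all add: twist_mult twist_inv twist_closed len_mult_le len_inv)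
  then obtain g where g: "g \<in> carrier G"
    and long: "\<And>j. j \<in> {0..<8 ^ N :: int} \<Longrightarrow> len (twist j g) > K" by blast
  let ?c = "\<lambda>(N, j). if 0 \<le> j \<and> j < 8 ^ N
    then (1/4) ^ N * (2 - 2 * decay N ^ len (twist j g)) else 0"
  have total: "(?c has_sum (norm (translation (g, 0)))\<^sup>2) UNIV"
  proof (rule has_sum_SigmaD[where f = "\<lambda>i. (displacement (g, 0) i)\<^sup>2" and B = "\<lambda>_. UNIV"])
    show "((\<lambda>i. (displacement (g, 0) i)\<^sup>2) has_sum (norm (translation (g, 0)))\<^sup>2) (UNIV \<times> UNIV)"
      using has_sum_norm_square[of "translation (g, 0)"] g by (simp add: coord_translation carrier_torus)
  qed (use displacement_fibre[OF g] in auto)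
  have small: "2 * decay N ^ len (twist j g) \<le> 1" if "j \<in> {0..<8 ^ N}" for j
    using K long[OF that] power_decreasing[of K "len (twist j g)" "decay N"] decay_pos[of N]
      decay_less_1[of N] by linarith
  have "(2 :: real) ^ N = (\<Sum>j\<in>{0..<8 ^ N :: int}. (1/4) ^ N)"
    by (simp add: power_mult_distrib[symmetric])
  also have "\<dots> \<le> (\<Sum>j\<in>{0..<8 ^ N}. ?c (N, j))"
    using small by (intro sum_mono) (simp add: mult_le_cancel_left1)
  also have "\<dots> = (\<Sum>a\<in>{N} \<times> {0..<8 ^ N}. ?c a)"
    by (simp add: sum.cartesian_product[symmetric])
  also have "\<dots> \<le> (norm (translation (g, 0)))\<^sup>2"
  proof (rule finite_sum_le_has_sum[OF total])
    fix a show "0 \<le> ?c a"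
      using displacement_fibre[OF g, THEN has_sum_nonneg, of "fst a" "snd a"]
      by (simp add: case_prod_beta)
  qed auto
  finally have "R\<^sup>2 < (norm (translation (g, 0)))\<^sup>2" using N by simp
  then have "R < norm (translation (g, 0))"
    using power2_less_imp_less[of R] by simp
  then show ?thesis using g by blast
qed

theorem affine_action_of_mapping_torus:
  "\<exists>(V :: ('a \<times> int \<Rightarrow> real) inner_product_space) \<alpha>.
     hilbert_space V \<and> affine_isometric_action (mapping_torus G \<phi>) V \<alpha> \<and>
     unbounded_orbits (mapping_torus G \<phi>) V \<alpha> \<and>
     \<not> (\<exists>x\<in>carrier V. \<forall>\<gamma>\<in>carrier G \<times> {0}. \<alpha> \<gamma> x = x)"
proof (rule affine_isometric_action_on_image[where A = "\<lambda>\<gamma> x. linear_part \<gamma> x + translation \<gamma>"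
      and L = linear_part and b = translation])
  (* Vectors have countably many coordinates, so the integer component can number them. *)
  let ?T = "\<lambda>(x :: ((nat \<times> int) \<times> nat fset) ell2) (g :: 'a, n :: int). coord x (from_nat (nat n))"
  show "inj ?T"
  proof (rule injI)
    fix x y assume eq: "?T x = ?T y"
    show "x = y"
    proof (rule ell2_eqI)
      fix i show "coord x i = coord y i"
        using fun_cong[OF eq, of "(undefined, int (to_nat i))"] by simp
    qed
  qed
  show "group (mapping_torus G \<phi>)" by (rule group_mapping_torus[OF is_group auto])
  have one: "\<one>\<^bsub>mapping_torus G \<phi>\<^esub> = (\<one>, 0)" by (simp add: mapping_torus_def)
  show "linear_part \<one>\<^bsub>mapping_torus G \<phi>\<^esub> x + translation \<one>\<^bsub>mapping_torus G \<phi>\<^esub> = x" for x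
    by (intro ell2_eqI)
      (simp add: coord_add coord_linear_part coord_translation carrier_torus one displacement_def
        torus_rep_one[unfolded one])
  show "linear_part (\<gamma> \<otimes>\<^bsub>mapping_torus G \<phi>\<^esub> \<delta>) x + translation (\<gamma> \<otimes>\<^bsub>mapping_torus G \<phi>\<^esub> \<delta>)
      = linear_part \<gamma> (linear_part \<delta> x + translation \<delta>) + translation \<gamma>"
    if "\<gamma> \<in> carrier (mapping_torus G \<phi>)" "\<delta> \<in> carrier (mapping_torus G \<phi>)" for \<gamma> \<delta> x
    using that by (simp add: linear_part_mult translation_mult linear_add[OF linear_linear_part])
  show "\<exists>\<gamma>\<in>carrier G \<times> {0}. dist (linear_part \<gamma> x + translation \<gamma>) x > R" for x R
  proof -
    obtain g where g: "g \<in> carrier G" "norm (translation (g, 0)) > R + 2 * norm x"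
      using unbounded_translation by blast
    have "norm (translation (g, 0)) \<le> norm (linear_part (g, 0) x + translation (g, 0) - x) + norm (x - linear_part (g, 0) x)"
      using norm_triangle_ineq[of "linear_part (g, 0) x + translation (g, 0) - x" "x - linear_part (g, 0) x"]
      by (simp add: algebra_simps)
    also have "norm (x - linear_part (g, 0) x) \<le> 2 * norm x"
      using norm_triangle_ineq4[of x "linear_part (g, 0) x"] g(1) by (simp add: norm_linear_part carrier_torus)
    finally show ?thesis
      using g by (intro bexI[of _ "(g, 0)"]) (auto simp: dist_norm)
  qed
qed (use linear_linear_part norm_linear_part in \<open>auto simp: carrier_torus\<close>)

end


section \<open>Commensurated sets from normal forms\<close>

context group
begin

text \<open>The set of points at which \<open>X\<close> and its translate by the inverse of \<open>g\<close> differ; \<open>X\<close> is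
  commensurated if all boundaries are finite.\<close>

definition boundary :: "'a set \<Rightarrow> 'a \<Rightarrow> 'a set" where
  "boundary X g = {x \<in> carrier G. (x \<in> X) \<noteq> (g \<otimes> x \<in> X)}"

lemma boundary_one: "boundary X \<one> = {}"
  by (auto simp: boundary_def)

lemma finite_boundary_mult:
  assumes "g \<in> carrier G" "h \<in> carrier G" "finite (boundary X g)" "finite (boundary X h)"
  shows "finite (boundary X (g \<otimes> h))"
proof (rule finite_subset)
  show "boundary X (g \<otimes> h) \<subseteq> boundary X h \<union> (\<otimes>) (inv h) ` boundary X g"
  proof
    fix x assume x: "x \<in> boundary X (g \<otimes> h)"
    then have xc: "x \<in> carrier G" by (simp add: boundary_def)
    have "x = inv h \<otimes> (h \<otimes> x)" using assms(2) xc by (simp add: m_assoc[symmetric])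
    moreover have "x \<in> boundary X h \<or> h \<otimes> x \<in> boundary X g"
      using x assms(1,2) by (auto simp: boundary_def m_assoc)
    ultimately show "x \<in> boundary X h \<union> (\<otimes>) (inv h) ` boundary X g" by blast
  qed
qed (use assms in auto)

text \<open>Left translation of the group becomes an action on natural numbers by means of an enumeration of the
  group, extended trivially to the numbers outside its range.\<close>

lemma commensurating_action_on_nat:
  assumes countable: "countable (carrier G)" and X: "X \<subseteq> carrier G"
    and finite: "\<And>g. g \<in> carrier G \<Longrightarrow> finite (boundary X g)"
  obtains \<sigma> :: "'a \<Rightarrow> nat \<Rightarrow> nat" and Y where "commensurating_action G \<sigma> Y"
    and "\<And>g. g \<in> carrier G \<Longrightarrow> card (sym_diff Y (\<sigma> g ` Y)) = card (boundary X g)"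
proof -
  let ?e = "to_nat_on (carrier G)" and ?d = "inv_into (carrier G) (to_nat_on (carrier G))"
  have inj: "inj_on ?e (carrier G)" by (rule inj_on_to_nat_on[OF countable])
  define \<sigma> where "\<sigma> g n = (if n \<in> ?e ` carrier G then ?e (g \<otimes> ?d n) else n)" for g n
  have \<sigma>: "\<sigma> g (?e x) = ?e (g \<otimes> x)" if "x \<in> carrier G" for g x
    using that inj by (simp add: \<sigma>_def)
  have eq: "sym_diff (?e ` X) (\<sigma> g ` ?e ` X) = ?e ` (\<otimes>) g ` boundary X g"
    if g: "g \<in> carrier G" for g
  proof -
    have cancel: "g \<otimes> (inv g \<otimes> y) = y" "inv g \<otimes> (g \<otimes> y) = y" if "y \<in> carrier G" for y
      using that g by (simp_all add: m_assoc[symmetric])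
    have translate: "y \<in> (\<otimes>) g ` Z \<longleftrightarrow> y \<in> carrier G \<and> inv g \<otimes> y \<in> Z"
      if "Z \<subseteq> carrier G" for y Z
    proof
      assume "y \<in> (\<otimes>) g ` Z"
      then show "y \<in> carrier G \<and> inv g \<otimes> y \<in> Z" using that g cancel(2) by auto
    next
      assume "y \<in> carrier G \<and> inv g \<otimes> y \<in> Z"
      then show "y \<in> (\<otimes>) g ` Z" using cancel(1) by (intro image_eqI[of _ _ "inv g \<otimes> y"]) auto
    qed
    have mem: "x \<in> boundary X g \<longleftrightarrow> x \<in> carrier G \<and> (x \<in> X) \<noteq> (g \<otimes> x \<in> X)" for x
      by (simp add: boundary_def)
    then have sub: "boundary X g \<subseteq> carrier G" by blast
    have "x \<in> carrier G" if "x \<in> X" for x using that X by blast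
    then have "sym_diff X ((\<otimes>) g ` X) = (\<otimes>) g ` boundary X g"
      using g by (auto simp: translate[OF X] translate[OF sub] mem cancel)
    moreover have "\<sigma> g ` ?e ` X = ?e ` (\<otimes>) g ` X"
      using X by (auto simp: image_image \<sigma> subset_iff intro!: image_cong)
    moreover have "sym_diff (?e ` X) (?e ` (\<otimes>) g ` X) = ?e ` sym_diff X ((\<otimes>) g ` X)"
      using X g by (subst image_Un, subst (1 2) inj_on_image_set_diff[OF inj]) auto
    ultimately show ?thesis by simp
  qed
  have card: "card (sym_diff (?e ` X) (\<sigma> g ` ?e ` X)) = card (boundary X g)" if g: "g \<in> carrier G" for g
  proof -
    have "boundary X g \<subseteq> carrier G" by (auto simp: boundary_def)
    moreover have "(\<otimes>) g ` boundary X g \<subseteq> carrier G" using g by (auto simp: boundary_def)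
    ultimately show ?thesis
      unfolding eq[OF g] using g
      by (simp add: card_image inj_on_subset[OF inj] inj_on_subset[OF inj_on_cmult[OF g]])
  qed
  have "commensurating_action G \<sigma> (?e ` X)"
  proof (intro commensurating_action.intro commensurating_action_axioms.intro)
    fix g h n assume "g \<in> carrier G" "h \<in> carrier G"
    then show "\<sigma> (g \<otimes> h) n = \<sigma> g (\<sigma> h n)"
      by (cases "n \<in> ?e ` carrier G") (auto simp: \<sigma> m_assoc, simp add: \<sigma>_def)
  next
    fix n show "\<sigma> \<one> n = n"
      by (cases "n \<in> ?e ` carrier G") (auto simp: \<sigma>, simp add: \<sigma>_def)
  next
    fix g assume "g \<in> carrier G"
    then show "finite (sym_diff (?e ` X) (\<sigma> g ` ?e ` X))"
      using finite by (simp add: eq)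
  qed (rule is_group)
  then show thesis using card that by blast
qed

lemma word_product_simps:
  "word_product G [] = \<one>" "word_product G (x # xs) = x \<otimes> word_product G xs"
  by (simp_all add: word_product_def)

lemma word_product_closed: "set xs \<subseteq> carrier G \<Longrightarrow> word_product G xs \<in> carrier G"
  by (induction xs) (auto simp: word_product_simps)

lemma word_product_append:
  "\<lbrakk>set xs \<subseteq> carrier G; set ys \<subseteq> carrier G\<rbrakk>
    \<Longrightarrow> word_product G (xs @ ys) = word_product G xs \<otimes> word_product G ys"
  by (induction xs) (auto simp: word_product_simps word_product_closed m_assoc)

lemma countable_if_finitely_generated:
  assumes "finitely_generated G"
  shows "countable (carrier G)"
proof -
  obtain S where S: "finite S" "S \<subseteq> carrier G" "generate G S = carrier G"
    using assms by (auto simp: finitely_generated_def)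
  let ?ev = "\<lambda>ws. word_product G (map (free_letter G) ws)"
  have letters: "set (map (free_letter G) ws) \<subseteq> carrier G" if "ws \<in> lists (S \<times> UNIV)" for ws
    using that S(2) by (auto simp: free_letter_def)
  have "g \<in> ?ev ` lists (S \<times> UNIV)" if "g \<in> generate G S" for g
    using that
  proof induction
    case one
    show ?case by (rule image_eqI[of _ _ "[]"]) (simp_all add: word_product_simps)
  next
    case (incl h)
    then show ?case
      using S(2) by (intro image_eqI[of _ _ "[(h, True)]"]) (auto simp: word_product_simps free_letter_def)
  next
    case (inv h)
    then show ?case
      using S(2) by (intro image_eqI[of _ _ "[(h, False)]"]) (auto simp: word_product_simps free_letter_def)
  next
    case (eng g h)
    then obtain u v where uv: "u \<in> lists (S \<times> UNIV)" "v \<in> lists (S \<times> UNIV)" "g = ?ev u" "h = ?ev v"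
      by blast
    then have "g \<otimes> h = ?ev (u @ v)"
      using word_product_append[OF letters letters, of u v] by simp
    then show ?case using uv(1,2) by (intro image_eqI[of _ _ "u @ v"]) auto
  qed
  then have "carrier G \<subseteq> ?ev ` lists (S \<times> UNIV)" using S(3) by blast
  moreover have "countable (lists (S \<times> (UNIV :: bool set)))"
    using S(1) by (intro countable_lists countable_SIGMA countable_finite) auto
  ultimately show ?thesis by (meson countable_image countable_subset)
qed

end

locale normal_forms = group G for G (structure) +
  fixes W :: "'l list set" and f :: "'l \<Rightarrow> 'a" and L :: "'a set"
  assumes bij: "bij_betw (\<lambda>ws. word_product G (map f ws)) W (carrier G)"
    and letters: "L \<subseteq> carrier G" "ws \<in> W \<Longrightarrow> f ` set ws \<subseteq> L"
begin

abbreviation ev :: "'l list \<Rightarrow> 'a" where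
  "ev ws \<equiv> word_product G (map f ws)"

definition ending :: "('l \<Rightarrow> bool) \<Rightarrow> 'a set" where
  "ending P = ev ` {ws \<in> W. ws \<noteq> [] \<and> P (last ws)}"

lemma ending_subset: "ending P \<subseteq> carrier G"
  using bij_betw_imp_surj_on[OF bij] by (auto simp: ending_def)

lemma ev_closed: "ws \<in> W \<Longrightarrow> ev ws \<in> carrier G"
  using bij_betw_imp_surj_on[OF bij] by blast

lemma ev_eq_iff: "\<lbrakk>ws \<in> W; vs \<in> W\<rbrakk> \<Longrightarrow> ev ws = ev vs \<longleftrightarrow> ws = vs"
  using bij_betw_imp_inj_on[OF bij] by (auto dest: inj_onD)

lemma ev_mem_ending: "ws \<in> W \<Longrightarrow> ev ws \<in> ending P \<longleftrightarrow> ws \<noteq> [] \<and> P (last ws)"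
  unfolding ending_def using ev_eq_iff by blast

text \<open>In a free product or a free group, multiplication by a letter on the left affects only the
  beginning of a normal form; the hypothesis \<open>step\<close> captures this. It leaves at most two elements in the boundary of a letter, and
  the boundary of a product is covered by translates of the boundaries of its factors.\<close>

lemma finite_boundary_ending:
  assumes step: "\<And>l ws. \<lbrakk>l \<in> L; ws \<in> W\<rbrakk> \<Longrightarrow>
      \<exists>vs\<in>W. l \<otimes> ev ws = ev vs \<and> (ws \<noteq> [] \<longrightarrow> vs \<noteq> [] \<longrightarrow> P (last ws) = P (last vs))"
    and g: "g \<in> carrier G"
  shows "finite (boundary (ending P) g)"
proof -
  have letter: "finite (boundary (ending P) l)" if l: "l \<in> L" for l
  proof (rule finite_subset)
    have lc: "l \<in> carrier G" using l letters(1) by blast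
    show "boundary (ending P) l \<subseteq> {\<one>, inv l}"
    proof
      fix x assume x: "x \<in> boundary (ending P) l"
      then have xc: "x \<in> carrier G" by (simp add: boundary_def)
      then obtain ws where ws: "ws \<in> W" "x = ev ws"
        using bij_betw_imp_surj_on[OF bij] by blast
      obtain vs where vs: "vs \<in> W" "l \<otimes> ev ws = ev vs"
        "ws \<noteq> [] \<Longrightarrow> vs \<noteq> [] \<Longrightarrow> P (last ws) = P (last vs)"
        using step[OF l ws(1)] by blast
      have "ws = [] \<or> vs = []"
        using x vs ws by (auto simp: boundary_def ev_mem_ending)
      then have "x = \<one> \<or> l \<otimes> x = \<one>"
        using ws(2) vs(2) by (auto simp: word_product_simps)
      then show "x \<in> {\<one>, inv l}"
        using lc xc inv_equality[of x l] inv_inv by (metis insertCI inv_comm)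
    qed
  qed simp
  obtain ws where ws: "ws \<in> W" "g = ev ws"
    using g bij_betw_imp_surj_on[OF bij] by blast
  have "finite (boundary (ending P) (ev us))" if "f ` set us \<subseteq> L" for us
    using that
  proof (induction us)
    case (Cons u us)
    have "f ` set (u # us) \<subseteq> carrier G" using Cons.prems letters(1) by (rule order_trans)
    then have "f u \<in> carrier G" "ev us \<in> carrier G" by (auto intro!: word_product_closed)
    then show ?case
      using Cons letter by (auto simp: word_product_simps intro!: finite_boundary_mult)
  qed (simp add: word_product_simps boundary_one)
  then show ?thesis using ws letters(2) by simp
qed

end

lemma less_card_if_inj_on_atMost:
  assumes "finite A" "inj_on x {..R :: nat}" "x ` {..R} \<subseteq> A"
  shows "R < card A"
  using card_mono[OF assms(1,3)] card_image[OF assms(2)] by simp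

text \<open>The set consists of the elements whose normal form ends in the first factor; up to inversion
  it is one side of an edge of the Bass-Serre tree. For nontrivial \<open>a\<close> and \<open>b\<close> in the first two
  factors, left multiplication by a high power of \<open>ab\<close> turns the end of each short alternating word
  in the inverses of \<open>a\<close> and \<open>b\<close> from the second factor to the first.\<close>

lemma unbounded_commensurated_set_free_product:
  fixes G (structure)
  assumes "group G" and fp: "is_free_product G Ks"
    and len: "2 \<le> length Ks" and nontriv: "Ks ! 0 \<noteq> {\<one>\<^bsub>G\<^esub>}" "Ks ! 1 \<noteq> {\<one>\<^bsub>G\<^esub>}"
  shows "\<exists>X\<subseteq>carrier G. (\<forall>g\<in>carrier G. finite (group.boundary G X g)) \<and>
    (\<forall>R. \<exists>g\<in>carrier G. R < card (group.boundary G X g))"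
proof -
  interpret group G by (rule assms(1))
  have sub: "subgroup (Ks ! i) G" if "i < length Ks" for i
    using fp that by (simp add: is_free_product_def)
  let ?W = "free_product_words G Ks"
  interpret normal_forms G ?W snd "\<Union>(set Ks)"
  proof unfold_locales
    show "\<Union>(set Ks) \<subseteq> carrier G"
      using fp subgroup.subset by (fastforce simp: is_free_product_def)
    show "snd ` set ws \<subseteq> \<Union>(set Ks)" if "ws \<in> ?W" for ws
      using that by (fastforce simp: free_product_words_def)
  qed (use fp in \<open>simp add: is_free_product_def\<close>)
  let ?X = "ending (\<lambda>l. fst l = 0)"
  have Cons: "(i, h) # ws \<in> ?W \<longleftrightarrow> i < length Ks \<and> h \<in> Ks ! i \<and> h \<noteq> \<one> \<and> ws \<in> ?W \<and>
      (ws = [] \<or> fst (hd ws) \<noteq> i)" for i h ws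
    by (cases ws) (auto simp: free_product_words_def)
  have Nil: "[] \<in> ?W" by (simp add: free_product_words_def)
  have fin: "finite (boundary ?X g)" if "g \<in> carrier G" for g
  proof (rule finite_boundary_ending[OF _ that])
    fix h ws assume "h \<in> \<Union>(set Ks)" and ws: "ws \<in> ?W"
    then obtain i where i: "i < length Ks" "h \<in> Ks ! i"
      by (auto simp: in_set_conv_nth)
    have hc: "h \<in> carrier G" using i sub subgroup.mem_carrier by metis
    show "\<exists>vs\<in>?W. h \<otimes> ev ws = ev vs \<and>
        (ws \<noteq> [] \<longrightarrow> vs \<noteq> [] \<longrightarrow> (fst (last ws) = 0) = (fst (last vs) = 0))"
    proof (cases "h = \<one>")
      case True
      then show ?thesis using ws by (intro bexI[of _ ws]) (auto simp: ev_closed)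
    next
      case h: False
      show ?thesis
      proof (cases "ws = [] \<or> fst (hd ws) \<noteq> i")
        case True
        then show ?thesis
          using ws h i by (intro bexI[of _ "(i, h) # ws"]) (auto simp: Cons word_product_simps)
      next
        case False
        then obtain k t where t: "ws = (i, k) # t" by (cases ws) auto
        have kt: "k \<in> Ks ! i" "t \<in> ?W" "t = [] \<or> fst (hd t) \<noteq> i"
          using ws by (auto simp: t Cons)
        have kc: "k \<in> carrier G" using kt(1) i sub subgroup.mem_carrier by metis
        have eq: "h \<otimes> ev ws = (h \<otimes> k) \<otimes> ev t"
          using hc kc ev_closed[OF kt(2)] by (simp add: t word_product_simps m_assoc)
        show ?thesis
        proof (cases "h \<otimes> k = \<one>")
          case True
          then show ?thesis
            using eq kt by (intro bexI[of _ t]) (auto simp: t ev_closed)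
        next
          case False
          moreover have "h \<otimes> k \<in> Ks ! i"
            using i kt sub by (simp add: subgroup.m_closed)
          ultimately show ?thesis
            using eq kt i by (intro bexI[of _ "(i, h \<otimes> k) # t"]) (auto simp: t Cons word_product_simps)
        qed
      qed
    qed
  qed
  have "\<exists>a\<in>Ks ! i. a \<noteq> \<one>" if "i < length Ks" "Ks ! i \<noteq> {\<one>}" for i
    using that subgroup.one_closed[OF sub[OF that(1)]] by blast
  then obtain a b where a: "a \<in> Ks ! 0" "a \<noteq> \<one>" and b: "b \<in> Ks ! 1" "b \<noteq> \<one>"
    using len nontriv by (metis One_nat_def Suc_le_lessD numeral_2_eq_2 less_trans zero_less_one)
  have sub01: "subgroup (Ks ! 0) G" "subgroup (Ks ! 1) G"
    using len by (auto intro!: sub)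
  have carr: "a \<in> carrier G" "b \<in> carrier G"
    using subgroup.mem_carrier[OF sub01(1) a(1)] subgroup.mem_carrier[OF sub01(2) b(1)] by auto
  have inv_mem: "inv a \<in> Ks ! 0" "inv b \<in> Ks ! 1"
    using subgroup.m_inv_closed[OF sub01(1) a(1)] subgroup.m_inv_closed[OF sub01(2) b(1)] by auto
  have inv_ne: "inv a \<noteq> \<one>" "inv b \<noteq> \<one>"
    using a(2) b(2) carr by (metis inv_inv inv_one)+
  (* The alternating word x y x ... y x with j letters y. *)
  define alt :: "nat \<times> 'a \<Rightarrow> nat \<times> 'a \<Rightarrow> nat \<Rightarrow> (nat \<times> 'a) list"
    where "alt x y j = ((\<lambda>ws. x # y # ws) ^^ j) [x]" for x y j
  have alt_simps: "alt x y 0 = [x]" "alt x y (Suc j) = x # y # alt x y j" for x y j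
    by (simp_all add: alt_def)
  have alt_ne: "alt x y j \<noteq> []" and alt_hd: "hd (alt x y j) = x" and alt_last: "last (alt x y j) = x"
    and alt_length: "length (alt x y j) = 2 * j + 1" for x y j
    by (induction j) (auto simp: alt_simps)
  define u v where "u = alt (0, a) (1, b)" and "v = alt (1, inv b) (0, inv a)"
  have uW: "u j \<in> ?W" and vW: "v j \<in> ?W" for j
    unfolding u_def v_def using a b inv_mem inv_ne len
    by (induction j) (auto simp: alt_simps Cons Nil alt_hd)
  let ?c = "a \<otimes> b"
  have cc: "?c \<in> carrier G" using carr by simp
  have up: "?c [^] i \<otimes> a = ev (u i)" for i :: nat
  proof (induction i)
    case (Suc i)
    have "?c [^] Suc i \<otimes> a = ?c \<otimes> (?c [^] i \<otimes> a)"
      using nat_pow_Suc2[OF cc] carr by (simp add: m_assoc)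
    then show ?case
      using Suc carr ev_closed[OF uW] by (simp add: u_def alt_simps word_product_simps m_assoc)
  qed (simp add: u_def alt_simps word_product_simps carr)
  have down: "?c [^] j \<otimes> ev (v j) = inv b" for j :: nat
  proof (induction j)
    case (Suc j)
    have "?c \<otimes> ev (v (Suc j)) = ev (v j)"
    proof -
      have "ev (v (Suc j)) = inv ?c \<otimes> ev (v j)"
        using carr ev_closed[OF vW]
        by (simp add: v_def alt_simps word_product_simps inv_mult_group m_assoc)
      then show ?thesis
        using cc ev_closed[OF vW] by (simp add: m_assoc[symmetric])
    qed
    then show ?case
      using Suc cc ev_closed[OF vW] by (simp add: m_assoc)
  qed (simp add: v_def alt_simps word_product_simps carr)
  have "R < card (boundary ?X (?c [^] Suc R))" for R
  proof (rule less_card_if_inj_on_atMost)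
    show "finite (boundary ?X (?c [^] Suc R))" using fin cc by simp
    show "inj_on (\<lambda>j. ev (v j)) {..R}"
    proof (rule inj_onI)
      fix i j assume "ev (v i) = ev (v j)"
      then have "length (v i) = length (v j)" by (simp add: ev_eq_iff vW)
      then show "i = j" by (simp add: v_def alt_length)
    qed
    show "(\<lambda>j. ev (v j)) ` {..R} \<subseteq> boundary ?X (?c [^] Suc R)"
    proof (rule image_subsetI)
      fix j assume j: "j \<in> {..R}"
      have "?c [^] Suc R = ?c [^] (R - j) \<otimes> (?c \<otimes> ?c [^] j)"
        using j cc nat_pow_mult[OF cc, of "R - j" "Suc j"] nat_pow_Suc2[OF cc, of j]
        by (simp add: Suc_diff_le)
      then have "?c [^] Suc R \<otimes> ev (v j) = ?c [^] (R - j) \<otimes> (?c \<otimes> (?c [^] j \<otimes> ev (v j)))"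
        using cc ev_closed[OF vW] by (simp add: m_assoc)
      also have "\<dots> = ev (u (R - j))"
        using carr by (simp add: down m_assoc up)
      finally have "?c [^] Suc R \<otimes> ev (v j) \<in> ?X"
        by (simp only: ev_mem_ending[OF uW]) (simp add: u_def alt_ne alt_last)
      moreover have "ev (v j) \<notin> ?X"
        by (simp add: ev_mem_ending[OF vW]) (simp add: v_def alt_last)
      ultimately show "ev (v j) \<in> boundary ?X (?c [^] Suc R)"
        using ev_closed[OF vW] by (simp add: boundary_def)
    qed
  qed
  then show ?thesis using fin cc ending_subset by (intro exI[of _ ?X]) (meson nat_pow_closed)
qed

text \<open>The set consists of the elements whose reduced word ends in \<open>x\<close>. A high power of \<open>x\<close> moves small powers
  of the inverse of \<open>x\<close> into it.\<close>

lemma unbounded_commensurated_set_free_group: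
  fixes G (structure)
  assumes "group G" and fb: "free_basis G (carrier G) B" and x: "x \<in> B"
  shows "\<exists>X\<subseteq>carrier G. (\<forall>g\<in>carrier G. finite (group.boundary G X g)) \<and>
    (\<forall>R. \<exists>g\<in>carrier G. R < card (group.boundary G X g))"
proof -
  interpret group G by (rule assms(1))
  have B: "B \<subseteq> carrier G" using fb by (simp add: free_basis_def)
  let ?W = "free_words B"
  interpret normal_forms G ?W "free_letter G" "free_letter G ` (B \<times> UNIV)"
  proof unfold_locales
    show "free_letter G ` (B \<times> UNIV) \<subseteq> carrier G"
      using B by (auto simp: free_letter_def)
    show "free_letter G ` set ws \<subseteq> free_letter G ` (B \<times> UNIV)" if "ws \<in> ?W" for ws
      using that by (auto simp: free_words_def)
  qed (use fb in \<open>simp add: free_basis_def\<close>)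
  let ?X = "ending (\<lambda>l. l = (x, True))"
  have Cons: "(y, c) # ws \<in> ?W \<longleftrightarrow> y \<in> B \<and> ws \<in> ?W \<and> (ws = [] \<or> hd ws \<noteq> (y, \<not> c))" for y c ws
    by (cases ws) (auto simp: free_words_def)
  have fin: "finite (boundary ?X g)" if "g \<in> carrier G" for g
  proof (rule finite_boundary_ending[OF _ that])
    fix l ws assume "l \<in> free_letter G ` (B \<times> UNIV)" and ws: "ws \<in> ?W"
    then obtain y c where y: "y \<in> B" "l = free_letter G (y, c)" by auto
    have yc: "y \<in> carrier G" using y(1) B by blast
    show "\<exists>vs\<in>?W. l \<otimes> ev ws = ev vs \<and>
        (ws \<noteq> [] \<longrightarrow> vs \<noteq> [] \<longrightarrow> (last ws = (x, True)) = (last vs = (x, True)))"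
    proof (cases "ws = [] \<or> hd ws \<noteq> (y, \<not> c)")
      case True
      then show ?thesis
        using ws y by (intro bexI[of _ "(y, c) # ws"]) (auto simp: Cons word_product_simps)
    next
      case False
      then obtain t where t: "ws = (y, \<not> c) # t" by (cases ws) auto
      have tW: "t \<in> ?W" using ws by (simp add: t Cons)
      have "l \<otimes> ev ws = ev t"
        using yc ev_closed[OF tW]
        by (cases c) (simp_all add: y t word_product_simps free_letter_def m_assoc[symmetric])
      then show ?thesis using tW by (intro bexI[of _ t]) (auto simp: t)
    qed
  qed
  have xc: "x \<in> carrier G" using x B by blast
  have Nil: "[] \<in> ?W" by (simp add: free_words_def)
  have rep: "replicate n (x, c) \<in> ?W" for n c
    by (induction n) (use x in \<open>auto simp: Cons Nil\<close>)
  have ev_rep: "ev (replicate n (x, True)) = x [^] n" "ev (replicate n (x, False)) = inv x [^] n" for n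
    by (induction n) (use xc in \<open>simp_all add: word_product_simps free_letter_def nat_pow_Suc2[symmetric] del: nat_pow_Suc\<close>)
  have "R < card (boundary ?X (x [^] Suc R))" for R
  proof (rule less_card_if_inj_on_atMost)
    show "finite (boundary ?X (x [^] Suc R))" using fin xc by simp
    show "inj_on (\<lambda>j. ev (replicate j (x, False))) {..R}"
      by (rule inj_onI) (metis ev_eq_iff rep length_replicate)
    show "(\<lambda>j. ev (replicate j (x, False))) ` {..R} \<subseteq> boundary ?X (x [^] Suc R)"
    proof (rule image_subsetI)
      fix j assume j: "j \<in> {..R}"
      have "x [^] Suc R = x [^] Suc (R - j) \<otimes> x [^] j"
        using j xc nat_pow_mult[OF xc, of "Suc (R - j)" j] by simp
      then have "x [^] Suc R \<otimes> ev (replicate j (x, False)) = x [^] Suc (R - j) \<otimes> (x [^] j \<otimes> inv (x [^] j))"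
        using xc by (simp only: ev_rep nat_pow_inv) (simp add: m_assoc)
      also have "\<dots> = ev (replicate (Suc (R - j)) (x, True))"
        using xc by (simp only: ev_rep) simp
      finally have "x [^] Suc R \<otimes> ev (replicate j (x, False)) \<in> ?X"
        by (simp only: ev_mem_ending[OF rep]) simp
      moreover have "ev (replicate j (x, False)) \<notin> ?X"
        by (cases j) (simp_all only: ev_mem_ending[OF rep], simp_all)
      ultimately show "ev (replicate j (x, False)) \<in> boundary ?X (x [^] Suc R)"
        using ev_closed[OF rep] by (simp add: boundary_def)
    qed
  qed
  then show ?thesis using fin xc ending_subset by (intro exI[of _ ?X]) (meson nat_pow_closed)
qed

text \<open>If there is no factor besides the free group, the splitting as a free product is trivial and the
  reduced words in a basis take over.\<close>

lemma unbounded_commensurated_set: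
  fixes G (structure)
  assumes "group G" and fp: "is_free_product G (Hs @ [F])" and F: "free_subgroup_of_rank G F r"
    and nontriv: "\<forall>H\<in>set Hs. H \<noteq> {\<one>\<^bsub>G\<^esub>}" and rank: "length Hs + r \<ge> 2"
  shows "\<exists>X\<subseteq>carrier G. (\<forall>g\<in>carrier G. finite (group.boundary G X g)) \<and>
    (\<forall>R. \<exists>g\<in>carrier G. R < card (group.boundary G X g))"
proof -
  interpret group G by (rule assms(1))
  obtain B where B: "free_basis G F B" "finite B" "card B = r"
    using F by (auto simp: free_subgroup_of_rank_def)
  show ?thesis
  proof (cases Hs)
    case Nil
    have sF: "subgroup F G" using B(1) by (simp add: free_basis_def)
    have "word_product G (map snd ws) \<in> F" if "ws \<in> free_product_words G [F]" for ws
    proof -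
      have "set (map snd ws) \<subseteq> F" using that by (auto simp: free_product_words_def)
      then show ?thesis
        by (induction ws) (auto simp: word_product_simps subgroup.one_closed[OF sF] subgroup.m_closed[OF sF])
    qed
    then have "(\<lambda>ws. word_product G (map snd ws)) ` free_product_words G [F] \<subseteq> F"
      by (rule image_subsetI)
    moreover have "bij_betw (\<lambda>ws. word_product G (map snd ws)) (free_product_words G [F]) (carrier G)"
      using fp by (simp add: Nil is_free_product_def)
    ultimately have "carrier G \<subseteq> F"
      by (simp add: bij_betw_imp_surj_on)
    then have "F = carrier G" using subgroup.subset[OF sF] by blast
    moreover obtain x where "x \<in> B" using B rank Nil by fastforce
    ultimately show ?thesis
      using B(1) unbounded_commensurated_set_free_group[OF assms(1)] by blast
  next
    case (Cons H Hs')
    have "(Hs @ [F]) ! 1 \<noteq> {\<one>}"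
    proof (cases Hs')
      case Nil
      have "B \<noteq> {}" using B(3) rank by (auto simp: Cons Nil)
      then obtain x where x: "x \<in> B" by blast
      then have xF: "x \<in> F" using B(1) by (auto simp: free_basis_def)
      then have "x \<in> carrier G" using B(1) subgroup.mem_carrier by (metis free_basis_def)
      moreover have "inj_on (\<lambda>ws. word_product G (map (free_letter G) ws)) (free_words B)"
        using B(1) unfolding free_basis_def by (blast intro: bij_betw_imp_inj_on)
      then have "word_product G (map (free_letter G) [(x, True)]) \<noteq> word_product G (map (free_letter G) [])"
        using x by (subst inj_on_eq_iff) (auto simp: free_words_def)
      ultimately have "x \<noteq> \<one>"
        by (simp add: word_product_simps free_letter_def)
      then have "F \<noteq> {\<one>}" using xF by blast
      then show ?thesis by (simp add: Cons Nil)
    qed (use nontriv in \<open>simp add: Cons\<close>)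
    then show ?thesis
      using nontriv by (intro unbounded_commensurated_set_free_product[OF assms(1) fp]) (simp_all add: Cons)
  qed
qed


section \<open>The mapping torus of a free product\<close>

theorem corollary1p2:
  fixes G :: "('a, 'b) monoid_scheme"
    and Hs :: "'a set list"
    and F :: "'a set"
    and r :: nat
    and \<phi> :: "'a \<Rightarrow> 'a"
  assumes "group G"
    and "finitely_generated G"
    and "torsion_free G"
    and "is_free_product G (Hs @ [F])"
    and "free_subgroup_of_rank G F r"
    and "\<forall>H\<in>set Hs. H \<noteq> {\<one>\<^bsub>G\<^esub>}"
    and "\<phi> \<in> auto G"
    and "preserves_system G \<phi> Hs"
    and "length Hs + r \<ge> 3"
    and "fully_irreducible G Hs \<phi>"
    and "atoroidal G Hs \<phi>"
    and "no_twinned_subgroups G Hs \<phi>"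
  shows "\<exists>(V :: ('a \<times> int \<Rightarrow> real) inner_product_space) \<alpha>.
           hilbert_space V \<and>
           affine_isometric_action (mapping_torus G \<phi>) V \<alpha> \<and>
           unbounded_orbits (mapping_torus G \<phi>) V \<alpha> \<and>
           \<not> (\<exists>x\<in>carrier V. \<forall>g\<in>carrier G. \<alpha> (g, 0) x = x)"
proof -
  interpret group G by (rule assms(1))
  have countable: "countable (carrier G)"
    by (rule countable_if_finitely_generated[OF assms(2)])
  have rank: "length Hs + r \<ge> 2" using assms(9) by simp
  obtain X where X: "X \<subseteq> carrier G" "\<And>g. g \<in> carrier G \<Longrightarrow> finite (boundary X g)"
    and unbounded: "\<And>R. \<exists>g\<in>carrier G. R < card (boundary X g)"
    using unbounded_commensurated_set[OF assms(1,4,5,6) rank] by blast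
  obtain \<sigma> :: "'a \<Rightarrow> nat \<Rightarrow> nat" and Y where action: "commensurating_action G \<sigma> Y"
    and card: "\<And>g. g \<in> carrier G \<Longrightarrow> card (sym_diff Y (\<sigma> g ` Y)) = card (boundary X g)"
    using commensurating_action_on_nat[OF countable X] by blast
  interpret commensurating_action G \<sigma> Y by (rule action)
  interpret torus_of_commensurating_action G \<sigma> Y \<phi>
  proof unfold_locales
    show "\<exists>g\<in>carrier G. R < len g" for R
      using unbounded[of R] card by (auto simp: len_def wall_def)
  qed (use assms(7) countable in auto)
  show ?thesis
    using affine_action_of_mapping_torus by auto
qed

end
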